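(* For every integer $d\ge 2$ with $d\ne 3,5,7,9$, there exists a free nonabelian mixing subgroup of $\mathrm{Aut}(\mathbb{T}^d)$ which is not mixing of order $3$.
   Context: $\mathbb{T}^d=\mathbb{R}^d/\mathbb{Z}^d$ with normalized Haar measure $m$; $\mathcal{B}$ is the completion of its Borel $\sigma$-algebra; $\mathrm{Aut}(\mathbb{T}^d)$ is the group of continuous automorphisms. A subgroup $\Gamma$ is mixing if for all $A,B\in\mathcal{B}$, $m(A\cap\gamma^{-1}B)\to m(A)m(B)$ as $\gamma\to\infty$ in $\Gamma$ (i.e. as $\gamma$ leaves every finite subset of $\Gamma$). It is mixing of order $s$ if for all $B_1,\ldots,B_s\in\mathcal{B}$, $m(\gamma_1^{-1}B_1\cap(\gamma_2\gamma_1)^{-1}B_2\cap\cdots\cap(\gamma_s\cdots\gamma_1)^{-1}B_s)\to m(B_1)\cdots m(B_s)$ as the products $\gamma_j\cdots\gamma_i\to\infty$ for all $1<i\le j\le s$, where $\gamma_1,\ldots,\gamma_s\in\Gamma$; that is, for every $\varepsilon>0$ there is a finite $K\subset\Gamma$ such that the two sides differ by less than $\varepsilon$ whenever $\gamma_j\cdots\gamma_i\notin K$ for all $1<i\le j\le s$. *)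

theory Defs
  imports "HOL-Analysis.Analysis" "HOL-Algebra.Bij"
begin

section \<open>The torus as a topological group\<close>

definition int_lattice :: "(real ^ 'n) set"
  where "int_lattice = {z. \<forall>i. z $ i \<in> \<int>}"

lemma int_lattice_add: "x \<in> int_lattice \<Longrightarrow> y \<in> int_lattice \<Longrightarrow> x + y \<in> int_lattice"
  and int_lattice_diff: "x \<in> int_lattice \<Longrightarrow> y \<in> int_lattice \<Longrightarrow> x - y \<in> int_lattice"
  and int_lattice_minus: "x \<in> int_lattice \<Longrightarrow> - x \<in> int_lattice"
  and int_lattice_0: "0 \<in> int_lattice"
  by (auto simp: int_lattice_def)

quotient_type (overloaded) 'n torus = "real ^ ('n :: finite)" / "\<lambda>x y. x - y \<in> int_lattice"
  morphisms rep_torus to_torus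
proof (rule equivpI)
  show "reflp (\<lambda>x y :: real ^ 'n. x - y \<in> int_lattice)"
    by (simp add: reflp_def int_lattice_0)
  show "symp (\<lambda>x y :: real ^ 'n. x - y \<in> int_lattice)"
    using int_lattice_minus by (fastforce simp: symp_def)
  show "transp (\<lambda>x y :: real ^ 'n. x - y \<in> int_lattice)"
    using int_lattice_add by (fastforce simp: transp_def)
qed

instantiation torus :: (finite) ab_group_add
begin

lift_definition zero_torus :: "'a torus" is 0 .

lift_definition plus_torus :: "'a torus \<Rightarrow> 'a torus \<Rightarrow> 'a torus" is "(+)"
  by (metis add_diff_add int_lattice_add)

lift_definition uminus_torus :: "'a torus \<Rightarrow> 'a torus" is uminus
  using int_lattice_minus by fastforce

lift_definition minus_torus :: "'a torus \<Rightarrow> 'a torus \<Rightarrow> 'a torus" is "(-)"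
proof -
  fix a b c d :: "real ^ 'a"
  assume "a - b \<in> int_lattice" "c - d \<in> int_lattice"
  from int_lattice_diff[OF this] show "a - c - (b - d) \<in> int_lattice"
    by (simp add: algebra_simps)
qed

instance
  by standard (transfer; simp add: int_lattice_0 algebra_simps)+

end

lemma to_torus_add: "to_torus (x + y) = to_torus x + to_torus y"
  by (simp add: plus_torus.abs_eq)

lemma to_torus_eq_iff: "to_torus x = to_torus y \<longleftrightarrow> x - y \<in> int_lattice"
  by (rule torus.abs_eq_iff)

lemma surj_to_torus: "surj to_torus"
  by (metis Quotient_torus Quotient_abs_rep surjI)

instantiation torus :: (finite) topological_space
begin

definition open_torus :: "'a torus set \<Rightarrow> bool"
  where "open_torus U \<longleftrightarrow> open (to_torus -` U)"

instance
  by standard (auto simp: open_torus_def vimage_Union)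

end

lemma continuous_on_to_torus: "continuous_on UNIV to_torus"
  by (simp add: continuous_on_open_vimage open_torus_def)

instance torus :: (finite) t2_space
proof
  fix x y :: "'a torus"
  assume "x \<noteq> y"
  obtain a b where x: "x = to_torus a" and y: "y = to_torus b"
    by (metis surj_to_torus surjD)
  with \<open>x \<noteq> y\<close> obtain i where i: "a $ i - b $ i \<notin> \<int>"
    by (auto simp: to_torus_eq_iff int_lattice_def)
  define e where "e = (\<lambda>v :: real ^ 'a. cis (2 * pi * v $ i))"
  have cis_eq: "cis (2 * pi * s) = cis (2 * pi * t) \<longleftrightarrow> s - t \<in> \<int>" for s t :: real
  proof -
    have "cis (2 * pi * s) = cis (2 * pi * t) \<longleftrightarrow> cis (2 * pi * (s - t)) = 1"
      by (simp add: cis_divide [symmetric] right_diff_distrib)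
    also have "\<dots> \<longleftrightarrow> (\<exists>n::int. (s - t) * (2 * pi) = of_int n * (2 * pi))"
      by (simp add: cis_conv_exp exp_eq_1 algebra_simps)
    also have "\<dots> \<longleftrightarrow> (\<exists>n::int. s - t = of_int n)"
      by (subst mult_cancel_right) simp
    finally show ?thesis
      by (auto simp: Ints_def)
  qed
  define E where "E = (\<lambda>t. e (rep_torus t))"
  have E: "E (to_torus v) = e v" for v
  proof -
    have "to_torus (rep_torus (to_torus v)) = to_torus v"
      by (metis Quotient_torus Quotient_abs_rep)
    then show ?thesis
      by (auto simp: E_def e_def cis_eq to_torus_eq_iff int_lattice_def)
  qed
  have open_E: "open (E -` W)" if "open W" for W
  proof -
    have "to_torus -` (E -` W) = e -` W"
      by (auto simp: E)
    moreover have "continuous_on UNIV e"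
      unfolding e_def by (intro continuous_intros)
    ultimately show ?thesis
      using that by (simp add: open_torus_def continuous_on_open_vimage)
  qed
  have "E x \<noteq> E y"
    using i by (simp add: x y E e_def cis_eq)
  from hausdorff[OF this] obtain U V
    where UV: "open U" "open V" "E x \<in> U" "E y \<in> V" "U \<inter> V = {}"
    by blast
  show "\<exists>U V. open U \<and> open V \<and> x \<in> U \<and> y \<in> V \<and> U \<inter> V = {}"
  proof (intro exI conjI)
    show "open (E -` U)" "open (E -` V)"
      using UV by (auto intro: open_E)
    show "x \<in> E -` U" "y \<in> E -` V" "E -` U \<inter> E -` V = {}"
      using UV by auto
  qed
qed

definition fund_cube :: "(real ^ 'n) set"
  where "fund_cube = {x. \<forall>i. 0 \<le> x $ i \<and> x $ i < 1}"

lemma fund_cube_unique: "\<exists>!z. z \<in> int_lattice \<and> x - z \<in> fund_cube"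
proof (intro ex1I conjI)
  let ?z = "\<chi> i. of_int \<lfloor>x $ i\<rfloor>"
  show "?z \<in> int_lattice"
    by (simp add: int_lattice_def)
  show "x - ?z \<in> fund_cube"
    by (simp add: fund_cube_def) linarith
  fix z assume z: "z \<in> int_lattice \<and> x - z \<in> fund_cube"
  show "z = ?z"
  proof (rule vec_eq_iff[THEN iffD2], rule allI)
    fix i
    from z obtain k where k: "z $ i = of_int k"
      by (auto simp: int_lattice_def elim!: Ints_cases)
    from z have "0 \<le> x $ i - z $ i" "x $ i - z $ i < 1"
      by (auto simp: fund_cube_def)
    with k have "\<lfloor>x $ i\<rfloor> = k"
      by (intro floor_unique) auto
    with k show "z $ i = ?z $ i" by simp
  qed
qed

lemma compact_torus: "compact (UNIV :: ('n :: finite) torus set)"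
proof -
  have "t \<in> to_torus ` cbox 0 1" for t :: "'n torus"
  proof -
    obtain x where "t = to_torus x"
      by (metis surj_to_torus surjD)
    moreover obtain z where z: "z \<in> int_lattice" "x - z \<in> fund_cube"
      using fund_cube_unique by blast
    ultimately have "t = to_torus (x - z)"
      by (simp add: to_torus_eq_iff)
    moreover have "x - z \<in> cbox 0 1"
      using z(2) by (auto simp: fund_cube_def mem_box_cart less_imp_le)
    ultimately show ?thesis by blast
  qed
  then have "to_torus ` cbox 0 1 = (UNIV :: 'n torus set)" by blast
  moreover have "compact (to_torus ` cbox 0 (1 :: real ^ 'n))"
    by (intro compact_continuous_image continuous_on_subset[OF continuous_on_to_torus]) auto
  ultimately show ?thesis by simp
qed

section \<open>Haar measure\<close>

text \<open>The image of Lebesgue measure on the unit cube; the lemmas \<open>emeasure_haar_borel_UNIV\<close> and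
  \<open>haar_borel_translate\<close> identify it as the normalized Haar measure on Borel sets.\<close>

definition haar_borel :: "('n :: finite) torus measure"
  where "haar_borel = distr (restrict_space lborel fund_cube) borel to_torus"

definition haar :: "('n :: finite) torus measure"
  where "haar = completion haar_borel"

lemma fund_cube_borel [measurable]: "fund_cube \<in> sets borel"
proof -
  have "fund_cube = (\<Inter>i. {x :: real ^ 'a. 0 \<le> x $ i} \<inter> {x. x $ i < 1})"
    by (auto simp: fund_cube_def)
  also have "\<dots> \<in> sets borel"
    by (intro sets.countable_INT' sets.Int borel_closed borel_open countableI_type
        closed_Collect_le open_Collect_less continuous_intros) auto
  finally show ?thesis .
qed

lemma to_torus_borel [measurable]: "to_torus \<in> borel_measurable borel"
  by (rule borel_measurable_continuous_onI[OF continuous_on_to_torus])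

lemma emeasure_haar_borel:
  assumes "A \<in> sets borel"
  shows "emeasure haar_borel A = emeasure lborel (to_torus -` A \<inter> fund_cube)"
  using assms
  by (simp add: haar_borel_def emeasure_distr measurable_restrict_space1 space_restrict_space
      emeasure_restrict_space Int_commute)

lemma emeasure_haar_borel_UNIV: "emeasure (haar_borel :: 'n :: finite torus measure) UNIV = 1"
proof -
  have "emeasure lborel (box 0 (1 :: real ^ 'n)) \<le> emeasure lborel (fund_cube :: (real ^ 'n) set)"
    by (intro emeasure_mono) (auto simp: fund_cube_def mem_box_cart less_imp_le)
  moreover have "emeasure lborel (fund_cube :: (real ^ 'n) set) \<le> emeasure lborel (cbox 0 (1 :: real ^ 'n))"
    by (intro emeasure_mono) (auto simp: fund_cube_def mem_box_cart less_imp_le)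
  moreover have "(0 :: real ^ 'n) \<bullet> b \<le> 1 \<bullet> b" "((1 :: real ^ 'n) - 0) \<bullet> b = 1" if "b \<in> Basis" for b
    using that by (auto simp: Basis_vec_def inner_axis)
  ultimately have "emeasure lborel (fund_cube :: (real ^ 'n) set) = 1"
    by (simp add: emeasure_lborel_box_eq emeasure_lborel_cbox_eq)
  then show ?thesis
    using emeasure_haar_borel[of "UNIV :: 'n torus set"] by simp
qed

lemma countable_int_lattice: "countable (int_lattice :: (real ^ 'n :: finite) set)"
proof -
  have "z \<in> range (\<lambda>k :: 'n \<Rightarrow> int. \<chi> i. of_int (k i))" if "z \<in> int_lattice" for z :: "real ^ 'n"
  proof (rule range_eqI)
    show "z = (\<chi> i. of_int \<lfloor>z $ i\<rfloor>)"
      using that by (auto simp: int_lattice_def vec_eq_iff elim!: Ints_cases dest!: spec)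
  qed
  then have "int_lattice \<subseteq> range (\<lambda>k :: 'n \<Rightarrow> int. (\<chi> i. of_int (k i)) :: real ^ 'n)" by blast
  moreover have "countable (UNIV :: ('n \<Rightarrow> int) set)"
    by (rule countableI_type)
  ultimately show ?thesis
    by (metis countable_image countable_subset)
qed

lemma haar_borel_translate: "distr haar_borel borel ((+) a) = haar_borel"
proof -
  have cont: "continuous_on UNIV ((+) a)"
  proof (rule continuous_on_open_vimage[THEN iffD2, rule_format])
    show "open (UNIV :: 'a torus set)" by simp
    fix U :: "'a torus set" assume "open U"
    obtain v where "a = to_torus v"
      by (metis surj_to_torus surjD)
    then have "to_torus -` ((+) a -` U) = (+) v -` (to_torus -` U)"
      by (auto simp: to_torus_add)
    moreover have "open ((+) v -` (to_torus -` U))"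
    proof (rule open_vimage)
      show "open (to_torus -` U)"
        using \<open>open U\<close> by (simp add: open_torus_def)
      show "continuous_on UNIV ((+) v)"
        by (intro continuous_intros)
    qed
    ultimately show "open ((+) a -` U \<inter> UNIV)"
      by (simp add: open_torus_def)
  qed
  then have meas: "(+) a \<in> borel_measurable borel"
    by (rule borel_measurable_continuous_onI)
  obtain v where v: "a = to_torus v"
    by (metis surj_to_torus surjD)
  let ?L = "emeasure (lborel :: (real ^ 'a) measure)"
  let ?C = "fund_cube :: (real ^ 'a) set"
  have shift_borel [measurable]: "(+) w -` X \<in> sets borel" if "X \<in> sets borel" for w and X :: "(real ^ 'a) set"
    using measurable_sets[of "(+) w" borel borel X] that by simp
  have shift: "?L ((+) w -` X) = ?L X" if "X \<in> sets borel" for w X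
  proof -
    have "?L X = emeasure (distr lborel borel ((+) w)) X"
      by (simp add: lborel_distr_plus)
    also have "\<dots> = ?L ((+) w -` X)"
      using that by (simp add: emeasure_distr)
    finally show ?thesis ..
  qed
  have split: "?L X = (\<integral>\<^sup>+z. ?L (X \<inter> S z) \<partial>count_space int_lattice)"
    if X: "X \<in> sets borel" and S: "\<And>z. S z \<in> sets borel"
      and part: "\<And>x. \<exists>!z. z \<in> int_lattice \<and> x \<in> S z" for X and S :: "real ^ 'a \<Rightarrow> (real ^ 'a) set"
  proof -
    have "X = (\<Union>z\<in>int_lattice. X \<inter> S z)"
      using part by blast
    then have "?L X = ?L (\<Union>z\<in>int_lattice. X \<inter> S z)"
      by simp
    also have "\<dots> = (\<integral>\<^sup>+z. ?L (X \<inter> S z) \<partial>count_space int_lattice)"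
    proof (rule emeasure_UN_countable)
      show "disjoint_family_on (\<lambda>z. X \<inter> S z) int_lattice"
        using part unfolding disjoint_family_on_def by blast
    qed (use X S countable_int_lattice in auto)
    finally show ?thesis .
  qed
  show ?thesis
  proof (rule measure_eqI)
    show "sets (distr haar_borel borel ((+) a)) = sets haar_borel"
      by (simp add: haar_borel_def)
    fix A assume "A \<in> sets (distr haar_borel borel ((+) a))"
    then have A: "A \<in> sets borel" by simp
    define E where "E = to_torus -` A"
    have E [measurable]: "E \<in> sets borel"
      using measurable_sets[OF to_torus_borel A] by (simp add: E_def)
    have E_periodic: "z + x \<in> E \<longleftrightarrow> x \<in> E" if "z \<in> int_lattice" for x z
    proof -
      have "to_torus (z + x) = to_torus x"
        using that by (simp add: to_torus_eq_iff)
      then show ?thesis by (simp add: E_def)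
    qed
    define D where "D = (+) (- v) -` ?C"
    have D [measurable]: "D \<in> sets borel"
      unfolding D_def by (intro shift_borel) simp
    have "emeasure (distr haar_borel borel ((+) a)) A = emeasure haar_borel ((+) a -` A)"
      using meas A by (simp add: emeasure_distr haar_borel_def)
    also have "\<dots> = ?L (to_torus -` ((+) a -` A) \<inter> ?C)"
      using measurable_sets[OF meas A] by (simp add: emeasure_haar_borel)
    also have "to_torus -` ((+) a -` A) \<inter> ?C = (+) v -` (E \<inter> D)"
      by (auto simp: v E_def D_def to_torus_add)
    also have "?L \<dots> = ?L (E \<inter> D)"
      by (intro shift) simp
    also have "\<dots> = (\<integral>\<^sup>+z. ?L (E \<inter> D \<inter> (+) (- z) -` ?C) \<partial>count_space int_lattice)"
      using fund_cube_unique by (intro split) (simp_all add: add.commute[of "- _"])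
    also have "\<dots> = (\<integral>\<^sup>+z. ?L (E \<inter> ?C \<inter> (+) (z - v) -` ?C) \<partial>count_space int_lattice)"
    proof (intro nn_integral_cong)
      fix z :: "real ^ 'a" assume "z \<in> space (count_space int_lattice)"
      then have z: "z \<in> int_lattice" by simp
      have "?L (E \<inter> D \<inter> (+) (- z) -` ?C) = ?L ((+) z -` (E \<inter> D \<inter> (+) (- z) -` ?C))"
        by (intro shift[symmetric]) simp
      also have "(+) z -` (E \<inter> D \<inter> (+) (- z) -` ?C) = E \<inter> ?C \<inter> (+) (z - v) -` ?C"
      proof (rule Set.set_eqI)
        fix x
        have "- v + (z + x) = z - v + x" "- z + (z + x) = x"
          by simp_all
        then have "z + x \<in> D \<longleftrightarrow> z - v + x \<in> ?C" "- z + (z + x) \<in> ?C \<longleftrightarrow> x \<in> ?C"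
          unfolding D_def by (metis vimage_eq)+
        then show "x \<in> (+) z -` (E \<inter> D \<inter> (+) (- z) -` ?C) \<longleftrightarrow> x \<in> E \<inter> ?C \<inter> (+) (z - v) -` ?C"
          using E_periodic[OF z, of x] by (metis Int_iff vimage_eq)
      qed
      finally show "?L (E \<inter> D \<inter> (+) (- z) -` ?C) = ?L (E \<inter> ?C \<inter> (+) (z - v) -` ?C)" .
    qed
    also have "\<dots> = ?L (E \<inter> ?C)"
    proof (rule split[symmetric])
      fix x :: "real ^ 'a"
      obtain z where z: "z \<in> int_lattice" "x - v - z \<in> ?C"
        and uniq: "\<And>z'. z' \<in> int_lattice \<Longrightarrow> x - v - z' \<in> ?C \<Longrightarrow> z' = z"
        using fund_cube_unique[of "x - v"] by blast
      show "\<exists>!z. z \<in> int_lattice \<and> x \<in> (+) (z - v) -` ?C"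
      proof (intro ex1I conjI)
        show "- z \<in> int_lattice"
          using z by (simp add: int_lattice_minus)
        show "x \<in> (+) (- z - v) -` ?C"
          using z by (simp add: algebra_simps)
        fix y assume y: "y \<in> int_lattice \<and> x \<in> (+) (y - v) -` ?C"
        then have "- y = z"
          by (intro uniq) (auto simp: int_lattice_minus algebra_simps)
        then show "y = - z" by auto
      qed
    qed auto
    also have "\<dots> = emeasure haar_borel A"
      using A by (simp add: emeasure_haar_borel E_def)
    finally show "emeasure (distr haar_borel borel ((+) a)) A = emeasure haar_borel A" .
  qed
qed

section \<open>Continuous automorphisms\<close>

definition torus_group :: "('n :: finite) torus monoid"
  where "torus_group = \<lparr>carrier = UNIV, mult = (+), one = 0\<rparr>"

definition Aut_torus :: "('n :: finite torus \<Rightarrow> 'n torus) monoid"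
  where "Aut_torus = AutoGroup torus_group
           \<lparr>carrier := {f \<in> carrier (AutoGroup torus_group). continuous_on UNIV f}\<rparr>"

lemma group_torus_group: "group torus_group"
proof (rule groupI)
  fix x :: "'a torus" assume "x \<in> carrier torus_group"
  show "\<exists>y\<in>carrier torus_group. y \<otimes>\<^bsub>torus_group\<^esub> x = \<one>\<^bsub>torus_group\<^esub>"
    by (intro bexI[of _ "- x"]) (auto simp: torus_group_def)
qed (simp_all add: torus_group_def add.assoc)

lemma mem_Aut_torus_iff:
  "f \<in> carrier Aut_torus \<longleftrightarrow> bij f \<and> (\<forall>x y. f (x + y) = f x + f y) \<and> continuous_on UNIV f"
  by (simp add: Aut_torus_def AutoGroup_def torus_group_def auto_def Bij_def hom_def conj_ac)

lemma mult_Aut_torus: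
  "f \<in> carrier Aut_torus \<Longrightarrow> g \<in> carrier Aut_torus \<Longrightarrow> f \<otimes>\<^bsub>Aut_torus\<^esub> g = f \<circ> g"
  by (simp add: Aut_torus_def AutoGroup_def BijGroup_def torus_group_def auto_def compose_def fun_eq_iff)

lemma group_Aut_torus: "group Aut_torus"
proof -
  let ?G = "AutoGroup (torus_group :: 'a torus monoid)"
  interpret group ?G
    by (rule group.AutoGroup[OF group_torus_group])
  let ?H = "{f \<in> carrier ?G. continuous_on UNIV f}"
  have mult: "f \<otimes>\<^bsub>?G\<^esub> g = f \<circ> g" if "f \<in> carrier ?G" "g \<in> carrier ?G" for f g
    using that by (auto simp: AutoGroup_def BijGroup_def torus_group_def auto_def compose_def)
  have one: "\<one>\<^bsub>?G\<^esub> = id"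
    by (auto simp: AutoGroup_def BijGroup_def torus_group_def)
  have "subgroup ?H ?G"
  proof (rule subgroupI)
    show "?H \<noteq> {}"
      using one one_closed by (auto intro!: exI[of _ id] simp: continuous_on_id)
    fix f assume f: "f \<in> ?H"
    let ?g = "inv\<^bsub>?G\<^esub> f"
    have "?g \<circ> f = id"
      using f mult[of ?g f] one by simp
    moreover have "surj f"
      using f by (auto simp: AutoGroup_def torus_group_def auto_def Bij_def bij_is_surj)
    ultimately have "continuous_on (f ` UNIV) ?g"
      using f by (intro continuous_on_inv compact_torus) (auto simp: fun_eq_iff)
    with f \<open>surj f\<close> show "?g \<in> ?H" by simp
  next
    fix f g assume "f \<in> ?H" "g \<in> ?H"
    then show "f \<otimes>\<^bsub>?G\<^esub> g \<in> ?H"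
      using m_closed[of f g] continuous_on_compose[of UNIV g f] continuous_on_subset[of UNIV f]
      by (simp add: mult)
  qed auto
  then have "group (?G \<lparr>carrier := ?H\<rparr>)"
    by (rule subgroup.subgroup_is_group) (rule group_axioms)
  then show ?thesis
    by (simp add: Aut_torus_def)
qed

section \<open>Free groups\<close>

text \<open>A letter \<open>(True, x)\<close> stands for \<open>x\<close> and \<open>(False, x)\<close> for its inverse.\<close>

definition word_val :: "('a, 'b) monoid_scheme \<Rightarrow> (bool \<times> 'a) list \<Rightarrow> 'a"
  where "word_val G w = foldr (\<lambda>(p, x) y. (if p then x else inv\<^bsub>G\<^esub> x) \<otimes>\<^bsub>G\<^esub> y) w \<one>\<^bsub>G\<^esub>"

definition reduced_word :: "(bool \<times> 'a) list \<Rightarrow> bool"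
  where "reduced_word w \<longleftrightarrow> successively (\<lambda>(p, x) (q, y). \<not> (x = y \<and> p \<noteq> q)) w"

definition free_basis :: "('a, 'b) monoid_scheme \<Rightarrow> 'a set \<Rightarrow> bool"
  where "free_basis G S \<longleftrightarrow> S \<subseteq> carrier G \<and>
           (\<forall>g \<in> carrier G. \<exists>!w. w \<in> lists (UNIV \<times> S) \<and> reduced_word w \<and> word_val G w = g)"

definition free_group :: "('a, 'b) monoid_scheme \<Rightarrow> bool"
  where "free_group G \<longleftrightarrow> group G \<and> (\<exists>S. free_basis G S)"

section \<open>Mixing\<close>

text \<open>The filter \<open>inf cofinite (principal \<Gamma>)\<close> is that of leaving every finite subset of \<open>\<Gamma>\<close>.\<close>

definition mixing :: "('n :: finite torus \<Rightarrow> 'n torus) set \<Rightarrow> bool"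
  where "mixing \<Gamma> \<longleftrightarrow> (\<forall>A \<in> sets haar. \<forall>B \<in> sets haar.
           ((\<lambda>\<gamma>. measure haar (A \<inter> \<gamma> -` B)) \<longlongrightarrow> measure haar A * measure haar B)
             (inf cofinite (principal \<Gamma>)))"

text \<open>\<open>comp_seq \<gamma> i j\<close> is the product \<open>\<gamma> j \<circ> \<dots> \<circ> \<gamma> i\<close>, with the largest index outermost.\<close>

definition comp_seq :: "(nat \<Rightarrow> 'a \<Rightarrow> 'a) \<Rightarrow> nat \<Rightarrow> nat \<Rightarrow> 'a \<Rightarrow> 'a"
  where "comp_seq \<gamma> i j = fold (\<lambda>k f. \<gamma> k \<circ> f) [i..<Suc j] id"

definition mixing_of_order :: "nat \<Rightarrow> ('n :: finite torus \<Rightarrow> 'n torus) set \<Rightarrow> bool"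
  where "mixing_of_order s \<Gamma> \<longleftrightarrow>
    (\<forall>B. (\<forall>k \<in> {1..s}. B k \<in> sets haar) \<longrightarrow>
      (\<forall>\<epsilon> > 0. \<exists>K. finite K \<and> K \<subseteq> \<Gamma> \<and>
        (\<forall>\<gamma>. (\<forall>k \<in> {1..s}. \<gamma> k \<in> \<Gamma>) \<and>
              (\<forall>i j. 1 < i \<and> i \<le> j \<and> j \<le> s \<longrightarrow> comp_seq \<gamma> i j \<notin> K) \<longrightarrow>
          \<bar>measure haar (\<Inter>k \<in> {1..s}. comp_seq \<gamma> 1 k -` B k) - (\<Prod>k \<in> {1..s}. measure haar (B k))\<bar> < \<epsilon>)))"

end

(* An automorphism group of the torus acts on the characters, that is, on the lattice of integer
   vectors. If no nontrivial element fixes a nonzero character, then the group is mixing. In the plane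
   there are free generators c_0, c_1, ..., acting freely on nonzero vectors by ping-pong on the second
   coordinate, such that c_(k+1) e - c_k e = 3 e for the first basis vector e. This linear relation
   between three characters holds for infinitely many k, which is incompatible with mixing of order 3.
   Direct sums of copies of this action settle even dimensions. In odd dimension d >= 11 one copy of
   dimension 9 is added, in which the free group acts by left multiplication with units on an order of a
   cubic division algebra over the rationals: there a nontrivial unit fixes no nonzero vector, and freeness
   follows from ping-pong in the real 3-dimensional representation. *)
theory Submission
  imports Defs "HOL-Probability.Probability_Measure"
begin

section \<open>Reduced words and ping-pong\<close>

text \<open>The obstacle is odd dimension: no nontrivial element may have the eigenvalue 1, and
  plane blocks alone fill only even dimensions. A noncommutative division algebra gives this
  property for free, but one of odd dimension over the rationals has dimension at least 9. The
  relation that destroys mixing of order 3 lives in a plane block, so the block of dimension 9 needs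
  a plane beside it, whence 11. All blocks must carry the same free group. The relation is wanted
  for infinitely many k, so the free group has infinitely many generators, and on the block of
  dimension 9 these are the conjugates \<open>g^k h g^-k\<close> for a suitable pair g, h. The
  algebra also shortens ping-pong: an element fixing some nonzero vector fixes 1, so only the orbit
  of 1 has to be followed.\<close>

definition inv_letter :: "bool \<times> 'a \<Rightarrow> bool \<times> 'a"
  where "inv_letter l = (\<not> fst l, snd l)"

lemma inv_letter_simps [simp]:
  "inv_letter (inv_letter l) = l" "inv_letter l \<noteq> l" "l \<noteq> inv_letter l" "inv_letter (p, x) = (\<not> p, x)"
  "inv_letter l = inv_letter l' \<longleftrightarrow> l = l'"
  by (auto simp: inv_letter_def prod_eq_iff)

definition inv_word :: "(bool \<times> 'a) list \<Rightarrow> (bool \<times> 'a) list"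
  where "inv_word w = rev (map inv_letter w)"

lemma reduced_word_iff: "reduced_word w \<longleftrightarrow> successively (\<lambda>l l'. l' \<noteq> inv_letter l) w"
  by (auto simp: reduced_word_def inv_letter_def prod_eq_iff split_beta
      intro!: arg_cong2[where f = successively] ext)

lemma reduced_word_Nil [simp]: "reduced_word []"
  by (simp add: reduced_word_iff)

lemma reduced_word_Cons: "reduced_word (l # w) \<longleftrightarrow> w = [] \<or> (hd w \<noteq> inv_letter l \<and> reduced_word w)"
  by (cases w) (auto simp: reduced_word_iff)

lemma reduced_word_append:
  "reduced_word (u @ w) \<longleftrightarrow> reduced_word u \<and> reduced_word w \<and> (u = [] \<or> w = [] \<or> hd w \<noteq> inv_letter (last u))"
  by (auto simp: reduced_word_iff successively_append_iff)

lemma reduced_word_inv_word [simp]: "reduced_word (inv_word w) \<longleftrightarrow> reduced_word w"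
  by (auto simp: reduced_word_iff inv_word_def successively_map inv_letter_def prod_eq_iff
      intro!: arg_cong2[where f = successively] ext)

lemma inv_word_simps [simp]: "inv_word [] = []" "inv_word (inv_word w) = w" "inv_word w = [] \<longleftrightarrow> w = []"
  by (auto simp: inv_word_def rev_map o_def)

locale inverse_letters =
  fixes T :: "bool \<times> 'a \<Rightarrow> 'v \<Rightarrow> 'v"
  assumes inv: "T (inv_letter l) (T l v) = v"
begin

lemma inv': "T l (T (inv_letter l) v) = v"
  using inv[of "inv_letter l"] by simp

lemma fold_inv_word: "fold T (inv_word w) (fold T w v) = v"
  by (induction w arbitrary: v) (auto simp: inv_word_def inv)

lemma fold_inv_word': "fold T w (fold T (inv_word w) v) = v"
  using fold_inv_word[of "inv_word w"] by simp

lemma reduce: "\<exists>w'. reduced_word w' \<and> (\<forall>v. fold T w' v = fold T w v)"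
proof (induction w)
  case Nil
  then show ?case by (intro exI[of _ "[]"]) simp
next
  case (Cons l w)
  then obtain w' where w': "reduced_word w'" "\<And>v. fold T w' v = fold T w v" by blast
  show ?case
  proof (cases "w' \<noteq> [] \<and> hd w' = inv_letter l")
    case True
    then obtain u where u: "w' = inv_letter l # u" by (metis list.collapse)
    with w' have "reduced_word u" by (auto simp: reduced_word_Cons)
    moreover have "fold T u v = fold T (l # w) v" for v
      using w'(2)[of "T l v"] by (simp add: u inv)
    ultimately show ?thesis by blast
  next
    case False
    with w' show ?thesis by (intro exI[of _ "l # w'"]) (auto simp: reduced_word_Cons)
  qed
qed

end

text \<open>One condition serves twice: it makes different reduced words act as different maps, and
  it makes stabilizers of nonzero characters trivial, which gives mixing.\<close>

locale free_letters = inverse_letters T for T :: "bool \<times> 'a \<Rightarrow> 'v :: zero \<Rightarrow> 'v" +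
  assumes free: "reduced_word w \<Longrightarrow> w \<noteq> [] \<Longrightarrow> fold T w v = v \<Longrightarrow> v = 0"
begin

text \<open>Once common last letters are cancelled, \<open>u @ inv_word w\<close> is reduced and
  fixes \<open>v\<close>, so it must be empty.\<close>

lemma fold_eq_imp_eq:
  assumes "reduced_word u" "reduced_word w" "v \<noteq> 0" "fold T u v = fold T w v"
  shows "u = w"
  using assms
proof (induction "length u" arbitrary: u w rule: less_induct)
  case less
  show ?case
  proof (cases "u \<noteq> [] \<and> w \<noteq> [] \<and> last u = last w")
    case True
    then obtain l u' w' where uw: "u = u' @ [l]" "w = w' @ [l]"
      by (metis append_butlast_last_id)
    have "T l (fold T u' v) = T l (fold T w' v)"
      using less.prems(4) uw by simp
    then have "fold T u' v = fold T w' v" by (metis inv)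
    then have "u' = w'"
      using less.hyps[of u' w'] less.prems(1-3) uw by (simp add: reduced_word_append)
    with uw show ?thesis by simp
  next
    case False
    have "reduced_word (u @ inv_word w)"
      using False less.prems by (auto simp: reduced_word_append) (auto simp: inv_word_def hd_rev last_map)
    moreover have "fold T (u @ inv_word w) v = v"
      using less.prems(4) fold_inv_word by simp
    ultimately have "u @ inv_word w = []"
      using free less.prems(3) by blast
    then show ?thesis by simp
  qed
qed

end

text \<open>Ping-pong with a height in place of explicit sets: as on a rooted tree, at most one step
  from a given vector fails to lead upwards.\<close>

locale height_letters = inverse_letters T for T :: "bool \<times> 'a \<Rightarrow> 'v :: zero \<Rightarrow> 'v" +
  fixes H :: "'v \<Rightarrow> int"
  assumes unique_descent: "v \<noteq> 0 \<Longrightarrow> H (T l v) \<le> H v \<Longrightarrow> H (T l' v) \<le> H v \<Longrightarrow> l = l'"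
    and T_0: "T l 0 = 0"
begin

text \<open>After a strict rise under \<open>l\<close>, the only letter that can fail to rise again
  is \<open>inv_letter l\<close>, and a reduced word cannot continue with it.\<close>

lemma height_fold:
  assumes "reduced_word w" "w \<noteq> []" "v \<noteq> 0" "H v < H (T (hd w) v)"
  shows "H v < H (fold T w v)"
  using assms
proof (induction w arbitrary: v)
  case (Cons l w)
  show ?case
  proof (cases "w = []")
    case False
    have "T l v \<noteq> 0" using Cons.prems(3) inv[of l v] T_0 by metis
    have "H (T (inv_letter l) (T l v)) \<le> H (T l v)" using Cons.prems(4) by (simp add: inv)
    with \<open>T l v \<noteq> 0\<close> have "H (T l v) < H (T (hd w) (T l v))"
      using unique_descent Cons.prems(1) False unfolding reduced_word_Cons by (meson not_le)
    with Cons \<open>T l v \<noteq> 0\<close> False have "H (T l v) < H (fold T w (T l v))"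
      by (auto simp: reduced_word_Cons)
    with Cons.prems(4) show ?thesis by simp
  qed (use Cons.prems in simp)
qed simp

text \<open>If a cyclically reduced word fixes \<open>v\<close>, so does its inverse, and neither
  can begin with a rise; but their first letters differ, against unique descent. Any other word is
  shortened by conjugating with its first letter.\<close>

sublocale free_letters T
proof
  fix w v assume "reduced_word w" "w \<noteq> []" "fold T w v = v"
  then show "v = 0"
  proof (induction "length w" arbitrary: w v rule: less_induct)
    case less
    show ?case
    proof (rule ccontr)
      assume v: "v \<noteq> 0"
      show False
      proof (cases "hd w = inv_letter (last w)")
        case False
        have "\<not> H v < H (T (hd w) v)"
          using height_fold less.prems v by fastforce
        moreover have "hd (inv_word w) = inv_letter (last w)"
          using less.prems(2) by (simp add: inv_word_def hd_rev last_map)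
        moreover have "fold T (inv_word w) v = v"
          using fold_inv_word[of w v] less.prems(3) by simp
        then have "\<not> H v < H (T (hd (inv_word w)) v)"
          using height_fold[of "inv_word w" v] less.prems v by auto
        ultimately show False
          using unique_descent v False by (metis not_le)
      next
        case True
        obtain l u where w: "w = l # u" using less.prems(2) by (cases w) auto
        have "u \<noteq> []" using True w by auto
        then obtain u' where u: "u = u' @ [inv_letter l]"
          using True w by (metis append_butlast_last_id inv_letter_simps(1) last_ConsR list.sel(1))
        have "u' \<noteq> []" using less.prems(1) by (auto simp: w u reduced_word_Cons)
        have "T (inv_letter l) (fold T u' (T l v)) = v"
          using less.prems(3) by (simp add: w u)
        then have "fold T u' (T l v) = T l v" by (metis inv')
        then have "T l v = 0"
          using less.hyps[of u'] less.prems(1) \<open>u' \<noteq> []\<close> by (auto simp: w u reduced_word_Cons reduced_word_append)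
        then show False using v inv[of l v] T_0 by metis
      qed
    qed
  qed
qed

end

text \<open>Letters act by the matrices \<open>U^(3k) J U^(3k+3)\<close>, where \<open>U\<close> is the elementary upper unipotent matrix and
  \<open>J\<close> the rotation by a right angle; the first columns of consecutive generators differ by \<open>(3, 0)\<close>.\<close>

fun plane :: "bool \<times> nat \<Rightarrow> int \<times> int \<Rightarrow> int \<times> int"
  where "plane (True, k) (x, y) = (3 * int k * x + (9 * int k * (int k + 1) - 1) * y, x + 3 * (int k + 1) * y)"
  | "plane (False, k) (x, y) = (3 * (int k + 1) * x - (9 * int k * (int k + 1) - 1) * y, - x + 3 * int k * y)"

lemma plane_add: "plane l (u + v) = plane l u + plane l v"
  by (cases l; cases "fst l"; cases u; cases v) (auto simp: algebra_simps)

text \<open>Each letter has its own integer j and moves (x, y) to height |x - 3 j y|. Two such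
  numbers differ by at least 3 |y|, whereas two heights of at most |y| allow a difference of only 2
  |y|; hence the spacing 3.\<close>

interpretation plane: height_letters plane "\<lambda>v. \<bar>snd v\<bar>"
proof
  fix l v show "plane (inv_letter l) (plane l v) = v"
    by (cases l; cases "fst l"; cases v) (auto simp: algebra_simps)
next
  fix l show "plane l 0 = 0"
    by (cases l; cases "fst l") (auto simp: zero_prod_def)
next
  fix v :: "int \<times> int" and l l' :: "bool \<times> nat"
  \<comment> \<open>Generators get the negative integers and inverses the nonnegative ones, so the
    numbering is injective.\<close>
  define j :: "bool \<times> nat \<Rightarrow> int" where "j l = (if fst l then - int (snd l) - 1 else int (snd l))" for l
  have snd_plane: "\<bar>snd (plane l v)\<bar> = \<bar>fst v - 3 * j l * snd v\<bar>" for l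
    by (cases l; cases "fst l"; cases v) (auto simp: j_def algebra_simps)
  assume v: "v \<noteq> 0" "\<bar>snd (plane l v)\<bar> \<le> \<bar>snd v\<bar>" "\<bar>snd (plane l' v)\<bar> \<le> \<bar>snd v\<bar>"
  have "j l = j l'"
  proof (rule ccontr)
    assume ne: "j l \<noteq> j l'"
    have "3 * \<bar>snd v\<bar> \<le> 3 * (\<bar>j l - j l'\<bar> * \<bar>snd v\<bar>)"
      using mult_right_mono[of 1 "\<bar>j l - j l'\<bar>" "\<bar>snd v\<bar>"] ne by simp
    also have "\<dots> = \<bar>3 * ((j l - j l') * snd v)\<bar>"
      by (simp add: abs_mult)
    also have "3 * ((j l - j l') * snd v) = (fst v - 3 * j l' * snd v) - (fst v - 3 * j l * snd v)"
      by (simp add: algebra_simps)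
    also have "\<bar>\<dots>\<bar> \<le> 2 * \<bar>snd v\<bar>" using v(2,3) unfolding snd_plane by linarith
    finally have "snd v = 0" by linarith
    with v(1,2) show False unfolding snd_plane by (auto simp: prod_eq_iff)
  qed
  then show "l = l'" by (cases l; cases l') (auto simp: j_def split: if_splits)
qed

section \<open>A cubic division algebra\<close>

text \<open>A triple \<open>(a, b, c)\<close> stands for \<open>a + b \<theta> + c \<theta>^2\<close>, where \<open>\<theta>^3 + \<theta>^2 - 2 \<theta> - 1 = 0\<close>; the field
  \<open>\<rat>(\<theta>)\<close> is cyclic with Galois group generated by \<open>\<theta> \<mapsto> \<theta>^2 - 2\<close>, and 2 is inert in it. The conjugates are
  numbered so that their absolute values decrease.\<close>

type_synonym zth = "int \<times> int \<times> int"

text \<open>These are 2 cos(6 pi / 7), 2 cos(2 pi / 7) and 2 cos(4 pi / 7), about -1.802, 1.247 and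
  -0.445; the interval isolates the first of them.\<close>

definition th1 :: real where "th1 = (SOME t. - 1.81 \<le> t \<and> t \<le> - 1.8 \<and> t ^ 3 + t\<^sup>2 - 2 * t - 1 = 0)"
definition th2 :: real where "th2 = th1\<^sup>2 - 2"
definition th3 :: real where "th3 = 1 - th1 - th1\<^sup>2"

lemma th1: "- 1.81 \<le> th1" "th1 \<le> - 1.8" "th1 ^ 3 = 1 + 2 * th1 - th1\<^sup>2"
proof -
  have "\<exists>t. - 1.81 \<le> t \<and> t \<le> - 1.8 \<and> t ^ 3 + t\<^sup>2 - 2 * t - 1 = (0::real)"
    by (intro IVT') (auto simp: power3_eq_cube power2_eq_square intro!: continuous_intros)
  from someI_ex[OF this] show "- 1.81 \<le> th1" "th1 \<le> - 1.8" "th1 ^ 3 = 1 + 2 * th1 - th1\<^sup>2"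
    unfolding th1_def[symmetric] by auto
qed

lemma th_relations:
  "th2 ^ 3 = 1 + 2 * th2 - th2\<^sup>2" "th3 ^ 3 = 1 + 2 * th3 - th3\<^sup>2"
  "th2\<^sup>2 = 3 - th1 - th1\<^sup>2" "th3 = th2\<^sup>2 - 2" "th3\<^sup>2 = th1 + 2"
  "th1 + th2 + th3 = - 1" "th1 * th2 + th2 * th3 + th3 * th1 = - 2" "th1 * th2 * th3 = 1"
proof -
  have "th1 + th2 + th3 = - 1" by (simp add: th2_def th3_def)
  moreover note th1(3)
  ultimately show "th2 ^ 3 = 1 + 2 * th2 - th2\<^sup>2" "th3 ^ 3 = 1 + 2 * th3 - th3\<^sup>2"
    "th2\<^sup>2 = 3 - th1 - th1\<^sup>2" "th3 = th2\<^sup>2 - 2" "th3\<^sup>2 = th1 + 2"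
    "th1 + th2 + th3 = - 1" "th1 * th2 + th2 * th3 + th3 * th1 = - 2" "th1 * th2 * th3 = 1"
    unfolding th2_def th3_def by (algebra, algebra, algebra, algebra, algebra, simp, algebra, algebra)
qed

text \<open>The ratio 1.41 is just within reach of the enclosure of \<open>th1\<close>; its 20th
  power, about 965, yields the factor 700 of \<open>g_gap\<close>.\<close>

lemma th_bounds: "1.41 * \<bar>th2\<bar> \<le> \<bar>th1\<bar>" "1.41 * \<bar>th3\<bar> \<le> \<bar>th2\<bar>" "th1 \<noteq> 0" "th2 \<noteq> 0" "th3 \<noteq> 0"
proof -
  have "1.8\<^sup>2 \<le> (- th1)\<^sup>2" "(- th1)\<^sup>2 \<le> 1.81\<^sup>2"
    using th1 by (intro power_mono; simp)+
  then have "1.24 \<le> th2" "th2 \<le> 1.2761" "- 0.4761 \<le> th3" "th3 \<le> - 0.43"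
    using th1 by (auto simp: th2_def th3_def power2_eq_square)
  then show "1.41 * \<bar>th2\<bar> \<le> \<bar>th1\<bar>" "1.41 * \<bar>th3\<bar> \<le> \<bar>th2\<bar>" "th1 \<noteq> 0" "th2 \<noteq> 0" "th3 \<noteq> 0"
    using th1 by auto
qed

fun zeval :: "real \<Rightarrow> zth \<Rightarrow> real" where "zeval t (a, b, c) = a + b * t + c * t\<^sup>2"

text \<open>Arithmetic in the basis 1, theta, theta^2, reduced by theta^3 = 1 + 2 theta - theta^2.
  Theta is a unit, so \<open>tdiv\<close> stays integral; \<open>galois\<close> substitutes theta^2
  - 2.\<close>

fun tmul :: "zth \<Rightarrow> zth" where "tmul (a, b, c) = (c, a + 2 * c, b - c)"
fun tdiv :: "zth \<Rightarrow> zth" where "tdiv (a, b, c) = (b - 2 * a, c + a, a)"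
fun galois :: "zth \<Rightarrow> zth" where "galois (a, b, c) = (a - 2 * b + 3 * c, - c, b - c)"
fun zmul :: "zth \<Rightarrow> zth \<Rightarrow> zth" where
  "zmul (a, b, c) (d, e, f) =
    (a * d + (b * f + c * e) - c * f, a * e + b * d + 2 * (b * f + c * e) - c * f,
     a * f + b * e + c * d - (b * f + c * e) + 3 * (c * f))"
fun znorm :: "zth \<Rightarrow> int" where
  "znorm (a, b, c) = a ^ 3 - a\<^sup>2 * b + 5 * a\<^sup>2 * c - 2 * a * b\<^sup>2 - a * b * c + 6 * a * c\<^sup>2
     + b ^ 3 - b\<^sup>2 * c - 2 * b * c\<^sup>2 + c ^ 3"
fun ztrace :: "zth \<Rightarrow> int" where "ztrace (a, b, c) = 3 * a - b + 5 * c"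

lemma zeval_add: "zeval t (x + y) = zeval t x + zeval t y"
  by (cases x; cases y) (simp add: algebra_simps)

lemma zeval_0 [simp]: "zeval t 0 = 0"
  by (simp add: zero_prod_def)

lemma zeval_tmul:
  assumes "t ^ 3 = 1 + 2 * t - t\<^sup>2"
  shows "zeval t (tmul x) = t * zeval t x"
proof -
  obtain a b c where x: "x = (a, b, c)" by (cases x)
  show ?thesis
    using assms unfolding x zeval.simps tmul.simps of_int_add of_int_diff of_int_mult of_int_numeral by algebra
qed

lemma zeval_galois: "zeval th1 (galois x) = zeval th2 x" "zeval th2 (galois x) = zeval th3 x" "zeval th3 (galois x) = zeval th1 x"
proof -
  have galois: "zeval t (galois x) = zeval s x" if "s = t\<^sup>2 - 2" "s\<^sup>2 = 3 - t - t\<^sup>2" for s t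
  proof -
    obtain a b c where x: "x = (a, b, c)" by (cases x)
    show ?thesis
      unfolding x zeval.simps galois.simps that(2) by (simp add: that(1) algebra_simps)
  qed
  show "zeval th1 (galois x) = zeval th2 x" "zeval th2 (galois x) = zeval th3 x" "zeval th3 (galois x) = zeval th1 x"
    by (intro galois; use th_relations(3-5) in \<open>simp add: th2_def th3_def\<close>)+
qed

lemma zeval_zmul:
  assumes "t ^ 3 = 1 + 2 * t - t\<^sup>2"
  shows "zeval t (zmul x y) = zeval t x * zeval t y"
proof -
  obtain a b c d e f where x: "x = (a, b, c)" "y = (d, e, f)" by (cases x; cases y)
  show ?thesis
    using assms unfolding x zeval.simps zmul.simps of_int_add of_int_diff of_int_mult of_int_numeral by algebra
qed

lemma znorm: "of_int (znorm x) = zeval th1 x * zeval th2 x * zeval th3 x"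
proof -
  obtain a b c where x: "x = (a, b, c)" by (cases x)
  show ?thesis
    using th1(3) unfolding x th2_def th3_def zeval.simps znorm.simps of_int_add of_int_diff of_int_mult of_int_power
      of_int_numeral by algebra
qed

lemma ztrace: "of_int (ztrace x) = zeval th1 x + zeval th2 x + zeval th3 x"
proof -
  obtain a b c where x: "x = (a, b, c)" by (cases x)
  show ?thesis
    using th1(3) th_relations unfolding x zeval.simps ztrace.simps by (simp, algebra)
qed

text \<open>The cubic is irreducible modulo 2, so reduction modulo 2 gives a field with eight
  elements, in which only 0 has norm 0. The proof checks the eight parity classes.\<close>

lemma znorm_double:
  assumes "even (znorm x)"
  shows "\<exists>y. x = y + y"
proof -
  obtain a b c where x: "x = (a, b, c)" by (cases x)
  have "even a \<and> even b \<and> even c"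
    using assms by (cases "even a"; cases "even b"; cases "even c") (simp_all add: x)
  then show ?thesis
    by (intro exI[of _ "(a div 2, b div 2, c div 2)"]) (simp add: x flip: mult_2)
qed

text \<open>A triple \<open>(x, y, z)\<close> stands for the element \<open>x + y u + z u^2\<close> of the cyclic algebra with
  \<open>u x = \<sigma>(x) u\<close> and \<open>u^3 = 2\<close>, and \<open>cmat\<close> is its real splitting.\<close>

type_synonym cyc = "zth \<times> zth \<times> zth"

fun cmat :: "cyc \<Rightarrow> real ^ 3 ^ 3" where
  "cmat (x, y, z) =
    vector [vector [zeval th1 x, zeval th1 y, zeval th1 z],
            vector [2 * zeval th2 z, zeval th2 x, zeval th2 y],
            vector [2 * zeval th3 y, 2 * zeval th3 z, zeval th3 x]]"

text \<open>The reduced norm, written as an integral form so that it can be examined modulo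
  2.\<close>

fun cdet :: "cyc \<Rightarrow> int" where
  "cdet (x, y, z) = znorm x + 2 * znorm y + 4 * znorm z - 2 * ztrace (zmul x (zmul (galois y) (galois (galois z))))"

lemma cdet: "det (cmat v) = of_int (cdet v)"
proof -
  obtain x y z where v: "v = (x, y, z)" by (cases v)
  note [simp] = zeval_galois zeval_zmul[OF th1(3)] zeval_zmul[OF th_relations(1)] zeval_zmul[OF th_relations(2)]
  show ?thesis
    by (simp add: v det_3 znorm ztrace algebra_simps)
qed

text \<open>Since u^3 = 2, the element 2 x + y u + z u^2 equals (y + z u + x u^2) u, and u has
  reduced norm 2.\<close>

lemma cdet_rotate: "cdet (x + x, y, z) = 2 * cdet (y, z, x)"
proof -
  have "det (cmat (x + x, y, z)) = 2 * det (cmat (y, z, x))"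
    by (simp add: det_3 zeval_add algebra_simps)
  then show ?thesis
    unfolding cdet by (metis of_int_eq_iff of_int_mult of_int_numeral)
qed

lemma cdet_0_imp_double: "cdet (x, y, z) = 0 \<Longrightarrow> \<exists>u. x = u + u \<and> cdet (y, z, u) = 0"
proof -
  assume *: "cdet (x, y, z) = 0"
  then have "znorm x = 2 * (ztrace (zmul x (zmul (galois y) (galois (galois z)))) - znorm y - 2 * znorm z)"
    by simp
  then obtain u where "x = u + u" using znorm_double by (metis dvd_triv_left)
  with * have "2 * cdet (y, z, u) = 0" using cdet_rotate[of u y z] by metis
  with \<open>x = u + u\<close> show ?thesis by (metis mult_eq_0_iff zero_neq_numeral)
qed

fun csize :: "cyc \<Rightarrow> nat" where
  "csize ((a, b, c), (d, e, f), (g, h, i)) = nat \<bar>a\<bar> + nat \<bar>b\<bar> + nat \<bar>c\<bar> + nat \<bar>d\<bar> + nat \<bar>e\<bar>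
    + nat \<bar>f\<bar> + nat \<bar>g\<bar> + nat \<bar>h\<bar> + nat \<bar>i\<bar>"

text \<open>2-adic descent: if the reduced norm vanishes, then every coordinate is even and halving all
  of them preserves this.\<close>

lemma cdet_0: "cdet v = 0 \<Longrightarrow> v = 0"
proof (induction "csize v" arbitrary: v rule: less_induct)
  case less
  obtain x y z where v: "v = (x, y, z)" by (cases v)
  obtain u where u: "x = u + u" "cdet (y, z, u) = 0"
    using less.prems cdet_0_imp_double unfolding v by blast
  obtain u' where u': "y = u' + u'" "cdet (z, u, u') = 0"
    using u(2) cdet_0_imp_double by blast
  obtain u'' where u'': "z = u'' + u''" "cdet (u, u', u'') = 0"
    using u'(2) cdet_0_imp_double by blast
  have size: "csize v = 2 * csize (u, u', u'')"
    by (cases u; cases u'; cases u'') (simp add: v u u' u'' abs_mult nat_mult_distrib)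
  have "(u, u', u'') = 0"
  proof (cases "csize (u, u', u'') > 0")
    case True
    then show ?thesis using less.hyps[OF _ u''(2)] size by simp
  next
    case False
    then show ?thesis by (cases u; cases u'; cases u'') (simp add: zero_prod_def)
  qed
  then show ?case by (simp add: v u u' u'' zero_prod_def)
qed

lemma cmat_add: "cmat (u + v) = cmat u + cmat v"
proof -
  obtain x y z x' y' z' where "u = (x, y, z)" "v = (x', y', z')" by (metis prod.exhaust)
  then show ?thesis by (simp add: vec_eq_iff forall_3 zeval_add)
qed

lemma cmat_0 [simp]: "cmat 0 = 0"
  using cmat_add[of 0 0] by simp

lemma cmat_diff: "cmat (u - v) = cmat u - cmat v"
  using cmat_add[of "u - v" v] by (simp add: algebra_simps)

text \<open>Absence of zero divisors, phrased with matrices so that a multiplication on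
  \<open>cyc\<close> never has to be introduced.\<close>

lemma cmat_mult_eq_0:
  assumes "cmat u ** cmat v = 0" "v \<noteq> 0"
  shows "u = 0"
proof -
  have "det (cmat v) \<noteq> 0" using assms(2) cdet_0[of v] by (auto simp: cdet)
  then have "det (cmat u) = 0" using assms(1) det_mul[of "cmat u" "cmat v"] by (simp add: det_0 flip: mat_0)
  then show ?thesis using cdet_0[of u] by (simp add: cdet)
qed

section \<open>Units of the algebra and their left multiplications\<close>

definition cyc_one :: cyc where "cyc_one = ((1, 0, 0), 0, 0)"

lemma cmat_cyc_one: "cmat cyc_one = mat 1"
  by (simp add: cyc_one_def vec_eq_iff forall_3 mat_def)

fun lmul_th :: "cyc \<Rightarrow> cyc" where "lmul_th (x, y, z) = (tmul x, tmul y, tmul z)"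
fun ldiv_th :: "cyc \<Rightarrow> cyc" where "ldiv_th (x, y, z) = (tdiv x, tdiv y, tdiv z)"
fun lmul_u :: "cyc \<Rightarrow> cyc" where "lmul_u (x, y, z) = (galois z + galois z, galois x, galois y)"

text \<open>Left multiplication by the unit \<open>(u - 1)^2\<close> and by its inverse \<open>3 u^2 + 4 u + 5\<close>, all of whose
  real matrix entries are nonzero.\<close>

definition lmul_c :: "cyc \<Rightarrow> cyc" where
  "lmul_c v = lmul_u (lmul_u v) - lmul_u v - lmul_u v + v"

definition ldiv_c :: "cyc \<Rightarrow> cyc" where
  "ldiv_c v = (let u = lmul_u v; w = lmul_u u in w + w + w + u + u + u + u + v + v + v + v + v)"

lemma tmul_tdiv: "tmul (tdiv x) = x" "tdiv (tmul x) = x"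
  by (cases x; simp)+

lemma lmul_th_ldiv_th [simp]: "lmul_th (ldiv_th v) = v" "ldiv_th (lmul_th v) = v"
  by (cases v; simp add: tmul_tdiv)+

lemma galois_add: "galois (x + y) = galois x + galois y"
  by (cases x; cases y) simp

lemma galois_cubed: "galois (galois (galois x)) = x"
  by (cases x) simp

lemma lmul_u_add: "lmul_u (v + w) = lmul_u v + lmul_u w"
  by (cases v; cases w) (simp add: galois_add)

lemma lmul_u_diff: "lmul_u (v - w) = lmul_u v - lmul_u w"
  using lmul_u_add[of "v - w" w] by (simp add: algebra_simps)

lemma lmul_u_cubed: "lmul_u (lmul_u (lmul_u v)) = v + v"
  by (cases v) (simp add: galois_cubed galois_add)

text \<open>From u^3 = 2 follows (u - 1) (u^2 + u + 1) = 1, and the square of u^2 + u + 1 is 3 u^2 +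
  4 u + 5.\<close>

lemma lmul_c_ldiv_c [simp]: "lmul_c (ldiv_c v) = v" "ldiv_c (lmul_c v) = v"
  by (simp_all add: lmul_c_def ldiv_c_def Let_def lmul_u_add lmul_u_diff lmul_u_cubed)

lemma lmul_th_add: "lmul_th (v + w) = lmul_th v + lmul_th w"
proof -
  have "tmul (x + y) = tmul x + tmul y" for x y by (cases x; cases y) simp
  then show ?thesis by (cases v; cases w) simp
qed

lemma ldiv_th_add: "ldiv_th (v + w) = ldiv_th v + ldiv_th w"
  using lmul_th_add[of "ldiv_th v" "ldiv_th w"] by (metis lmul_th_ldiv_th)

lemma lmul_c_add: "lmul_c (v + w) = lmul_c v + lmul_c w"
  by (simp add: lmul_c_def lmul_u_add)

lemma ldiv_c_add: "ldiv_c (v + w) = ldiv_c v + ldiv_c w"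
  using lmul_c_add[of "ldiv_c v" "ldiv_c w"] by (metis lmul_c_ldiv_c)

text \<open>The exponent 20 is even, which makes the three eigenvalues positive, and large enough to
  separate them by factors of 700.\<close>

definition lmul_g :: "cyc \<Rightarrow> cyc" where "lmul_g = lmul_th ^^ 20"
definition ldiv_g :: "cyc \<Rightarrow> cyc" where "ldiv_g = ldiv_th ^^ 20"

lemma funpow_cancel:
  fixes f g :: "'a \<Rightarrow> 'a"
  assumes "\<And>x. f (g x) = x"
  shows "(f ^^ n) ((g ^^ n) x) = x"
  by (induction n arbitrary: x) (simp_all add: assms funpow_swap1[of g])

lemma funpow_add_hom:
  fixes f :: "'a::plus \<Rightarrow> 'a"
  shows "(\<And>x y. f (x + y) = f x + f y) \<Longrightarrow> (f ^^ n) (x + y) = (f ^^ n) x + (f ^^ n) y"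
  by (induction n) simp_all

lemma g_cancel [simp]: "lmul_g (ldiv_g v) = v" "ldiv_g (lmul_g v) = v"
  by (simp_all add: lmul_g_def ldiv_g_def funpow_cancel)

lemma gk_cancel [simp]: "(lmul_g ^^ k) ((ldiv_g ^^ k) v) = v" "(ldiv_g ^^ k) ((lmul_g ^^ k) v) = v"
  by (simp_all add: funpow_cancel)

lemma g_add: "lmul_g (v + w) = lmul_g v + lmul_g w" "ldiv_g (v + w) = ldiv_g v + ldiv_g w"
  by (simp_all add: lmul_g_def ldiv_g_def funpow_add_hom lmul_th_add ldiv_th_add)

definition lmul_h :: "bool \<Rightarrow> cyc \<Rightarrow> cyc" where
  "lmul_h p v = lmul_c ((if p then lmul_g else ldiv_g) (ldiv_c v))"

text \<open>The conjugates of h by the powers of g turn a free pair into an infinite free family,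
  indexed like the letters of \<open>plane\<close>.\<close>

fun nine :: "bool \<times> nat \<Rightarrow> cyc \<Rightarrow> cyc" where
  "nine (p, k) v = (lmul_g ^^ k) (lmul_h p ((ldiv_g ^^ k) v))"

lemma nine_add: "nine l (v + w) = nine l v + nine l w"
  by (cases l) (simp add: lmul_h_def g_add funpow_add_hom lmul_c_add ldiv_c_add)

interpretation nine: inverse_letters nine
proof
  fix l v show "nine (inv_letter l) (nine l v) = v"
    by (cases l) (simp add: lmul_h_def)
qed

text \<open>Captures left multiplication by an element: acting on \<open>cmat\<close> by a fixed
  matrix from the left commutes with everything multiplied from the right.\<close>

definition equivariant :: "(cyc \<Rightarrow> cyc) \<Rightarrow> bool"
  where "equivariant f \<longleftrightarrow> (\<exists>M. \<forall>v. cmat (f v) = M ** cmat v)"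

lemma equivariant_comp: "equivariant f \<Longrightarrow> equivariant g \<Longrightarrow> equivariant (\<lambda>v. f (g v))"
  unfolding equivariant_def by (metis matrix_mul_assoc)

lemma equivariant_id: "equivariant (\<lambda>v. v)"
  unfolding equivariant_def by (metis matrix_mul_lid)

lemma equivariant_funpow: "equivariant f \<Longrightarrow> equivariant (f ^^ n)"
  by (induction n) (simp_all add: equivariant_id id_def equivariant_comp comp_def)

lemma matrix_add_rdistrib: "(A + B) ** C = A ** C + B ** C" for A B C :: "real ^ 3 ^ 3"
  by (simp add: matrix_matrix_mult_def vec_eq_iff sum.distrib distrib_right)

lemma matrix_diff_rdistrib: "(A - B) ** C = A ** C - B ** C" for A B C :: "real ^ 3 ^ 3"
  by (simp add: matrix_matrix_mult_def vec_eq_iff sum_subtractf left_diff_distrib)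

lemma equivariant_add: "equivariant f \<Longrightarrow> equivariant g \<Longrightarrow> equivariant (\<lambda>v. f v + g v)"
  unfolding equivariant_def cmat_add by (metis matrix_add_rdistrib)

lemma equivariant_diff: "equivariant f \<Longrightarrow> equivariant g \<Longrightarrow> equivariant (\<lambda>v. f v - g v)"
  unfolding equivariant_def cmat_diff by (metis matrix_diff_rdistrib)

lemma equivariant_fold: "(\<And>l. equivariant (f l)) \<Longrightarrow> equivariant (fold f w)"
  by (induction w) (simp_all add: equivariant_id id_def equivariant_comp comp_def)

lemma matrix_mult_3:
  fixes A B :: "real ^ 3 ^ 3"
  shows "(A ** B) $ i $ j = A $ i $ 1 * B $ 1 $ j + A $ i $ 2 * B $ 2 $ j + A $ i $ 3 * B $ 3 $ j"
  by (simp add: matrix_matrix_mult_def sum_3)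

lemma equivariant_lmul_u: "equivariant lmul_u"
proof -
  have "cmat (lmul_u v) = vector [vector [0, 1, 0], vector [0, 0, 1], vector [2, 0, 0]] ** cmat v" for v
  proof -
    obtain x y z where v: "v = (x, y, z)" by (metis prod.exhaust)
    show ?thesis by (simp add: v vec_eq_iff forall_3 matrix_mult_3 zeval_galois zeval_add)
  qed
  then show ?thesis unfolding equivariant_def by blast
qed

lemma cmat_lmul_th:
  "cmat (lmul_th v) = vector [vector [th1, 0, 0], vector [0, th2, 0], vector [0, 0, th3]] ** cmat v"
proof -
  obtain x y z where v: "v = (x, y, z)" by (metis prod.exhaust)
  show ?thesis
    by (simp add: v vec_eq_iff forall_3 matrix_mult_3
        zeval_tmul[OF th1(3)] zeval_tmul[OF th_relations(1)] zeval_tmul[OF th_relations(2)])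
qed

lemma equivariant_lmul_th: "equivariant lmul_th"
  using cmat_lmul_th unfolding equivariant_def by blast

text \<open>Evaluation at \<open>cyc_one\<close> exhibits \<open>cmat (g cyc_one)\<close> as a right
  inverse of the matrix of \<open>f\<close>; for square matrices it is then a left inverse
  too.\<close>

lemma equivariant_inverse:
  assumes "equivariant f" "\<And>v. f (g v) = v"
  shows "equivariant g"
proof -
  obtain M where M: "\<And>v. cmat (f v) = M ** cmat v"
    using assms(1) unfolding equivariant_def by blast
  define N where "N = cmat (g cyc_one)"
  have "M ** N = mat 1" using M[of "g cyc_one"] by (simp add: assms(2) cmat_cyc_one N_def)
  then have "N ** M = mat 1" by (simp add: matrix_left_right_inverse)
  then have "cmat (g v) = N ** cmat v" for v
    using M[of "g v"] by (simp add: assms(2) matrix_mul_assoc)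
  then show ?thesis unfolding equivariant_def by blast
qed

lemma equivariant_lmul_c: "equivariant lmul_c"
  unfolding lmul_c_def[abs_def]
  by (rule equivariant_add[OF equivariant_diff[OF equivariant_diff[OF
      equivariant_comp[OF equivariant_lmul_u equivariant_lmul_u] equivariant_lmul_u]
      equivariant_lmul_u] equivariant_id])

lemma equivariant_lmul_g: "equivariant lmul_g"
  unfolding lmul_g_def by (rule equivariant_funpow[OF equivariant_lmul_th])

lemma equivariant_nine: "equivariant (nine l)"
proof -
  obtain p k where l: "l = (p, k)" by (cases l)
  have c': "equivariant ldiv_c" and g': "equivariant ldiv_g"
    by (rule equivariant_inverse[OF equivariant_lmul_c lmul_c_ldiv_c(1)]
        equivariant_inverse[OF equivariant_lmul_g g_cancel(1)])+
  have "equivariant (if p then lmul_g else ldiv_g)"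
    using equivariant_lmul_g g' by simp
  then have "equivariant (lmul_h p)"
    unfolding lmul_h_def[abs_def]
    by (rule equivariant_comp[OF equivariant_lmul_c equivariant_comp[OF _ c']])
  then have "equivariant (\<lambda>v. (lmul_g ^^ k) (lmul_h p ((ldiv_g ^^ k) v)))"
    by (rule equivariant_comp[OF equivariant_funpow[OF equivariant_lmul_g]
        equivariant_comp[OF _ equivariant_funpow[OF g']]])
  moreover have "nine l = (\<lambda>v. (lmul_g ^^ k) (lmul_h p ((ldiv_g ^^ k) v)))"
    by (simp add: l fun_eq_iff)
  ultimately show ?thesis by simp
qed

lemma fold_nine_fixed:
  assumes "fold nine w v = v" "v \<noteq> 0"
  shows "fold nine w cyc_one = cyc_one"
proof -
  obtain M where M: "\<And>u. cmat (fold nine w u) = M ** cmat u"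
    using equivariant_fold[of nine w] equivariant_nine unfolding equivariant_def by blast
  \<comment> \<open>The algebra has no zero divisors, and left multiplications commute with right ones.\<close>
  have "cmat (fold nine w cyc_one - cyc_one) ** cmat v = M ** cmat v - cmat v"
    by (simp add: cmat_diff M cmat_cyc_one matrix_diff_rdistrib)
  also have "\<dots> = 0" using M[of v] assms(1) by simp
  finally have "fold nine w cyc_one - cyc_one = 0" by (rule cmat_mult_eq_0) (rule assms(2))
  then show ?thesis by simp
qed

section \<open>Ping-pong on the first column of the real matrices\<close>

fun q1 :: "cyc \<Rightarrow> real" where "q1 (x, y, z) = zeval th1 x"
fun q2 :: "cyc \<Rightarrow> real" where "q2 (x, y, z) = 2 * zeval th2 z"
fun q3 :: "cyc \<Rightarrow> real" where "q3 (x, y, z) = 2 * zeval th3 y"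

lemma q_add: "q1 (u + v) = q1 u + q1 v" "q2 (u + v) = q2 u + q2 v" "q3 (u + v) = q3 u + q3 v"
  by (cases u rule: prod_cases3; cases v rule: prod_cases3; simp add: zeval_add)+

lemma q_diff: "q1 (u - v) = q1 u - q1 v" "q2 (u - v) = q2 u - q2 v" "q3 (u - v) = q3 u - q3 v"
  using q_add[of "u - v" v] by simp_all

lemma q_u: "q1 (lmul_u v) = q2 v" "q2 (lmul_u v) = q3 v" "q3 (lmul_u v) = 2 * q1 v"
  by (cases v rule: prod_cases3; simp add: zeval_add zeval_galois)+

lemma q_c:
  "q1 (lmul_c v) = q1 v - 2 * q2 v + q3 v"
  "q2 (lmul_c v) = 2 * q1 v + q2 v - 2 * q3 v"
  "q3 (lmul_c v) = - 4 * q1 v + 2 * q2 v + q3 v"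
  by (simp_all add: lmul_c_def q_add q_diff q_u)

lemma q_c':
  "q1 (ldiv_c v) = 5 * q1 v + 4 * q2 v + 3 * q3 v"
  "q2 (ldiv_c v) = 6 * q1 v + 5 * q2 v + 4 * q3 v"
  "q3 (ldiv_c v) = 8 * q1 v + 6 * q2 v + 5 * q3 v"
  by (simp_all add: ldiv_c_def Let_def q_add q_u)

lemma q_th: "q1 (lmul_th v) = th1 * q1 v" "q2 (lmul_th v) = th2 * q2 v" "q3 (lmul_th v) = th3 * q3 v"
  by (cases v rule: prod_cases3; simp add: zeval_tmul[OF th1(3)] zeval_tmul[OF th_relations(1)] zeval_tmul[OF th_relations(2)])+

definition g1 :: real where "g1 = th1 ^ 20"
definition g2 :: real where "g2 = th2 ^ 20"
definition g3 :: real where "g3 = th3 ^ 20"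

lemma q_g:
  "q1 ((lmul_g ^^ k) v) = g1 ^ k * q1 v"
  "q2 ((lmul_g ^^ k) v) = g2 ^ k * q2 v"
  "q3 ((lmul_g ^^ k) v) = g3 ^ k * q3 v"
proof -
  have "q1 ((lmul_th ^^ n) v) = th1 ^ n * q1 v" "q2 ((lmul_th ^^ n) v) = th2 ^ n * q2 v"
    "q3 ((lmul_th ^^ n) v) = th3 ^ n * q3 v" for n v
    by (induction n) (simp_all add: q_th)
  then show "q1 ((lmul_g ^^ k) v) = g1 ^ k * q1 v"
    "q2 ((lmul_g ^^ k) v) = g2 ^ k * q2 v" "q3 ((lmul_g ^^ k) v) = g3 ^ k * q3 v"
    by (simp_all add: lmul_g_def g1_def g2_def g3_def funpow_mult flip: power_mult)
qed

lemma g_pos: "g1 > 0" "g2 > 0" "g3 > 0"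
  using th_bounds(3-5) by (simp_all add: g1_def g2_def g3_def zero_less_power_eq)

lemma g_gap: "700 * g2 \<le> g1" "700 * g3 \<le> g2"
proof -
  have *: "700 * s ^ 20 \<le> t ^ 20" if "1.41 * \<bar>s\<bar> \<le> \<bar>t\<bar>" for s t :: real
  proof -
    have "700 * s ^ 20 \<le> 1.41 ^ 20 * \<bar>s\<bar> ^ 20"
      by (intro mult_mono) (simp_all add: power_even_abs power_divide)
    also have "\<dots> \<le> \<bar>t\<bar> ^ 20"
      unfolding power_mult_distrib[symmetric] using that by (intro power_mono) auto
    finally show ?thesis by (simp add: power_even_abs)
  qed
  show "700 * g2 \<le> g1" "700 * g3 \<le> g2"
    unfolding g1_def g2_def g3_def using th_bounds by (auto intro!: *)
qed

lemma g_gap_power: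
  assumes "k > 0"
  shows "700 * g2 ^ k \<le> g1 ^ k" "700 * g3 ^ k \<le> g2 ^ k"
proof -
  have *: "700 * s ^ k \<le> t ^ k" if "700 * s \<le> t" "s > 0" for s t :: real
  proof -
    have "700 * s ^ k \<le> 700 ^ k * s ^ k"
      using that assms by (intro mult_right_mono self_le_power) auto
    also have "\<dots> \<le> t ^ k"
      unfolding power_mult_distrib[symmetric] using that by (intro power_mono) auto
    finally show ?thesis .
  qed
  show "700 * g2 ^ k \<le> g1 ^ k" "700 * g3 ^ k \<le> g2 ^ k"
    using g_gap g_pos by (auto intro!: *)
qed

text \<open>Neighbourhoods of the attracting lines of \<open>lmul_g\<close> (\<open>dom1\<close>)
  and of its inverse (\<open>dom3\<close>). The constants fit together: 100 exceeds the factor 6 of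
  \<open>comparable\<close>, and the eigenvalue gap 700 exceeds 6 times 100.\<close>

definition dom1 :: "cyc \<Rightarrow> bool"
  where "dom1 v \<longleftrightarrow> 100 * \<bar>q2 v\<bar> < \<bar>q1 v\<bar> \<and> 100 * \<bar>q3 v\<bar> < \<bar>q1 v\<bar>"
definition dom3 :: "cyc \<Rightarrow> bool"
  where "dom3 v \<longleftrightarrow> 100 * \<bar>q1 v\<bar> < \<bar>q3 v\<bar> \<and> 100 * \<bar>q2 v\<bar> < \<bar>q3 v\<bar>"
text \<open>Ping-pong in the first column of \<open>cmat\<close>: \<open>lmul_g\<close> has its attracting line and repelling plane at the
  coordinates, and those of its conjugate \<open>lmul_h\<close> are in general position to them.\<close>

definition comparable :: "cyc \<Rightarrow> bool"
  where "comparable v \<longleftrightarrow> (\<exists>t > 0. t \<le> \<bar>q1 v\<bar> \<and> \<bar>q1 v\<bar> \<le> 6 * t \<and>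
    t \<le> \<bar>q2 v\<bar> \<and> \<bar>q2 v\<bar> \<le> 6 * t \<and> t \<le> \<bar>q3 v\<bar> \<and> \<bar>q3 v\<bar> \<le> 6 * t)"
text \<open>The image of \<open>dom1\<close> or \<open>dom3\<close> under \<open>lmul_c\<close>,
  hence a neighbourhood of the attracting line of \<open>lmul_h p\<close>.\<close>

definition pong :: "bool \<Rightarrow> cyc \<Rightarrow> bool"
  where "pong p v \<longleftrightarrow> (if p then dom1 else dom3) (ldiv_c v)"

text \<open>The dominant coordinate decides: the other two terms contribute at most 0.08 |a| each,
  rounded up to 0.2 |a| in total. The last two bounds serve the case where the dominant coordinate
  stands last.\<close>

lemma abs_lincomb_bounds:
  fixes a b c :: real
  assumes "100 * \<bar>b\<bar> < \<bar>a\<bar>" "100 * \<bar>c\<bar> < \<bar>a\<bar>" "\<bar>\<beta>\<bar> \<le> 8" "\<bar>\<gamma>\<bar> \<le> 8"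
  shows "\<bar>\<alpha> * a + \<beta> * b + \<gamma> * c\<bar> \<le> (\<bar>\<alpha>\<bar> + 0.2) * \<bar>a\<bar>" "(\<bar>\<alpha>\<bar> - 0.2) * \<bar>a\<bar> \<le> \<bar>\<alpha> * a + \<beta> * b + \<gamma> * c\<bar>"
    "\<bar>\<gamma> * c + \<beta> * b + \<alpha> * a\<bar> \<le> (\<bar>\<alpha>\<bar> + 0.2) * \<bar>a\<bar>" "(\<bar>\<alpha>\<bar> - 0.2) * \<bar>a\<bar> \<le> \<bar>\<gamma> * c + \<beta> * b + \<alpha> * a\<bar>"
proof -
  define s where "s = \<beta> * b + \<gamma> * c"
  have "\<bar>\<beta>\<bar> * \<bar>b\<bar> \<le> 8 * (\<bar>a\<bar> / 100)" "\<bar>\<gamma>\<bar> * \<bar>c\<bar> \<le> 8 * (\<bar>a\<bar> / 100)"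
    using assms by (intro mult_mono; linarith)+
  then have "\<bar>s\<bar> \<le> 0.2 * \<bar>a\<bar>"
    using abs_triangle_ineq[of "\<beta> * b" "\<gamma> * c"] unfolding abs_mult s_def by linarith
  moreover have "\<bar>\<alpha> * a + s\<bar> \<le> \<bar>\<alpha> * a\<bar> + \<bar>s\<bar>" "\<bar>\<alpha> * a\<bar> - \<bar>s\<bar> \<le> \<bar>\<alpha> * a + s\<bar>"
    by linarith+
  ultimately have *: "\<bar>\<alpha> * a + s\<bar> \<le> (\<bar>\<alpha>\<bar> + 0.2) * \<bar>a\<bar>" "(\<bar>\<alpha>\<bar> - 0.2) * \<bar>a\<bar> \<le> \<bar>\<alpha> * a + s\<bar>"
    unfolding abs_mult distrib_right left_diff_distrib by linarith+
  then show "\<bar>\<alpha> * a + \<beta> * b + \<gamma> * c\<bar> \<le> (\<bar>\<alpha>\<bar> + 0.2) * \<bar>a\<bar>" "(\<bar>\<alpha>\<bar> - 0.2) * \<bar>a\<bar> \<le> \<bar>\<alpha> * a + \<beta> * b + \<gamma> * c\<bar>"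
    by (simp_all add: s_def add.assoc)
  from * show "\<bar>\<gamma> * c + \<beta> * b + \<alpha> * a\<bar> \<le> (\<bar>\<alpha>\<bar> + 0.2) * \<bar>a\<bar>" "(\<bar>\<alpha>\<bar> - 0.2) * \<bar>a\<bar> \<le> \<bar>\<gamma> * c + \<beta> * b + \<alpha> * a\<bar>"
    by (simp_all add: s_def add_ac)
qed

text \<open>The coefficients of \<open>q1\<close> have absolute values 1, 2, 4 in \<open>q_c\<close>
  and 5, 6, 8 in \<open>q_c'\<close>. With an error of 0.2 they stay in [0.8, 4.8] and [2, 12],
  which explains the witnesses and the factor 6.\<close>

lemma dom1_imp_comparable:
  assumes "dom1 v"
  shows "comparable (lmul_c v)" "comparable (ldiv_c v)"
proof -
  have v: "100 * \<bar>q2 v\<bar> < \<bar>q1 v\<bar>" "100 * \<bar>q3 v\<bar> < \<bar>q1 v\<bar>" "\<bar>q1 v\<bar> > 0"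
    using assms by (auto simp: dom1_def)
  note b = abs_lincomb_bounds(1,2)[OF v(1,2)]
  show "comparable (lmul_c v)"
    unfolding comparable_def q_c using b[of "-2" 1 1] b[of 1 "-2" 2] b[of 2 1 "-4"] v(3)
    by (intro exI[of _ "0.8 * \<bar>q1 v\<bar>"]) simp
  show "comparable (ldiv_c v)"
    unfolding comparable_def q_c' using b[of 4 3 5] b[of 5 4 6] b[of 6 5 8] v(3)
    by (intro exI[of _ "2 * \<bar>q1 v\<bar>"]) simp
qed

lemma dom3_imp_comparable:
  assumes "dom3 v"
  shows "comparable (lmul_c v)" "comparable (ldiv_c v)"
proof -
  have v: "100 * \<bar>q2 v\<bar> < \<bar>q3 v\<bar>" "100 * \<bar>q1 v\<bar> < \<bar>q3 v\<bar>" "\<bar>q3 v\<bar> > 0"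
    using assms by (auto simp: dom3_def)
  note b = abs_lincomb_bounds(3,4)[OF v(1,2)]
  show "comparable (lmul_c v)"
    unfolding comparable_def q_c using b[of "-2" 1 1] b[of 1 2 "-2"] b[of 2 "-4" 1] v(3)
    by (intro exI[of _ "0.8 * \<bar>q3 v\<bar>"]) simp
  show "comparable (ldiv_c v)"
    unfolding comparable_def q_c' using b[of 4 5 3] b[of 5 6 4] b[of 6 8 5] v(3)
    by (intro exI[of _ "2 * \<bar>q3 v\<bar>"]) simp
qed

lemma dom_imp_comparable: "dom1 v \<or> dom3 v \<Longrightarrow> comparable (lmul_c v) \<and> comparable (ldiv_c v)"
  using dom1_imp_comparable dom3_imp_comparable by blast

lemma comparable_not_dom: "comparable v \<Longrightarrow> \<not> dom1 v \<and> \<not> dom3 v"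
  unfolding comparable_def dom1_def dom3_def by auto

lemma pong_imp_comparable: "pong p v \<Longrightarrow> comparable v"
  using dom_imp_comparable[of "ldiv_c v"] by (auto simp: pong_def split: if_splits)

lemma dom_not_pong: "dom1 v \<or> dom3 v \<Longrightarrow> \<not> pong p v"
  using dom_imp_comparable[of v] comparable_not_dom by (auto simp: pong_def)

lemma comparable_imp_dom1:
  assumes "comparable v" "k > 0"
  shows "dom1 ((lmul_g ^^ k) v)"
proof -
  obtain t where t: "t > 0" "t \<le> \<bar>q1 v\<bar>" "\<bar>q2 v\<bar> \<le> 6 * t" "\<bar>q3 v\<bar> \<le> 6 * t"
    using assms(1) unfolding comparable_def by blast
  have *: "100 * (s * \<bar>x\<bar>) < g1 ^ k * \<bar>q1 v\<bar>" if "s > 0" "700 * s \<le> g1 ^ k" "\<bar>x\<bar> \<le> 6 * t" for s x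
  proof -
    have "100 * (s * \<bar>x\<bar>) \<le> 600 * s * t"
      using mult_left_mono[OF that(3), of s] that(1) by simp
    also have "\<dots> < 700 * s * t" using t(1) that(1) by simp
    also have "\<dots> \<le> g1 ^ k * \<bar>q1 v\<bar>"
      using t that by (intro mult_mono) auto
    finally show ?thesis .
  qed
  have "700 * g3 ^ k \<le> g1 ^ k"
    using g_gap_power[OF assms(2)] g_pos(3) zero_less_power[OF g_pos(3), of k] by linarith
  then show ?thesis
    using g_gap_power[OF assms(2)] t g_pos unfolding dom1_def q_g abs_mult
    by (simp add: *)
qed

text \<open>Argued backwards from \<open>v = (lmul_g ^^ k) w\<close>, so that the eigenvalue
  formulas \<open>q_g\<close> apply without inverses.\<close>

lemma comparable_imp_dom3:
  assumes "comparable v" "k > 0"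
  shows "dom3 ((ldiv_g ^^ k) v)"
proof -
  define w where "w = (ldiv_g ^^ k) v"
  have v: "v = (lmul_g ^^ k) w" by (simp add: w_def)
  obtain t where t: "t > 0" "t \<le> g3 ^ k * \<bar>q3 w\<bar>" "g1 ^ k * \<bar>q1 w\<bar> \<le> 6 * t" "g2 ^ k * \<bar>q2 w\<bar> \<le> 6 * t"
    using assms(1) g_pos unfolding comparable_def v q_g abs_mult by auto
  have *: "100 * \<bar>x\<bar> < \<bar>q3 w\<bar>" if "700 * g3 ^ k \<le> s" "s * \<bar>x\<bar> \<le> 6 * t" for s x
  proof -
    have "g3 ^ k * (700 * \<bar>x\<bar>) \<le> s * \<bar>x\<bar>"
      using mult_right_mono[OF that(1), of "\<bar>x\<bar>"] by simp
    also have "\<dots> < 7 * t" using that t(1) by linarith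
    also have "\<dots> \<le> g3 ^ k * (7 * \<bar>q3 w\<bar>)" using t(2) by simp
    finally show ?thesis using g_pos(3) by (simp add: mult_less_cancel_left)
  qed
  have "700 * g3 ^ k \<le> g1 ^ k"
    using g_gap_power[OF assms(2)] g_pos(3) zero_less_power[OF g_pos(3), of k] by linarith
  then show ?thesis
    using g_gap_power[OF assms(2)] t unfolding dom3_def w_def[symmetric]
    by (auto intro: *)
qed

lemma dom1_lmul_g: "dom1 v \<Longrightarrow> dom1 (lmul_g v)"
proof -
  assume "dom1 v"
  moreover have "100 * (s * \<bar>x\<bar>) < g1 * \<bar>q1 v\<bar>" if "0 < s" "s \<le> g1" "100 * \<bar>x\<bar> < \<bar>q1 v\<bar>" for s x
  proof -
    have "s * (100 * \<bar>x\<bar>) < s * \<bar>q1 v\<bar>" using that by simp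
    also have "\<dots> \<le> g1 * \<bar>q1 v\<bar>" using that by (intro mult_right_mono) auto
    finally show ?thesis by (simp add: mult_ac)
  qed
  ultimately show ?thesis
    using q_g[of 1 v] g_pos g_gap unfolding dom1_def by (simp add: abs_mult)
qed

lemma dom3_ldiv_g: "dom3 v \<Longrightarrow> dom3 (ldiv_g v)"
proof -
  define w where "w = ldiv_g v"
  have v: "v = lmul_g w" by (simp add: w_def)
  assume "dom3 v"
  have *: "100 * \<bar>x\<bar> < \<bar>q3 w\<bar>" if "g3 \<le> s" "100 * (s * \<bar>x\<bar>) < g3 * \<bar>q3 w\<bar>" for s x
  proof -
    have "g3 * (100 * \<bar>x\<bar>) \<le> s * (100 * \<bar>x\<bar>)" using that by (intro mult_right_mono) auto
    also have "\<dots> < g3 * \<bar>q3 w\<bar>" using that by (simp add: mult_ac)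
    finally show ?thesis using g_pos(3) by (simp add: mult_less_cancel_left)
  qed
  have "100 * (g1 * \<bar>q1 w\<bar>) < g3 * \<bar>q3 w\<bar>" "100 * (g2 * \<bar>q2 w\<bar>) < g3 * \<bar>q3 w\<bar>"
    using \<open>dom3 v\<close> q_g[of 1 w] g_pos unfolding dom3_def v by (simp_all add: abs_mult)
  moreover have "g3 \<le> g2" "g3 \<le> g1" using g_gap g_pos by linarith+
  ultimately have "dom3 w" unfolding dom3_def by (blast intro: *)
  then show ?thesis by (simp add: w_def)
qed

lemma pong_lmul_h: "pong p v \<Longrightarrow> pong p (lmul_h p v)"
  by (auto simp: pong_def lmul_h_def dom1_lmul_g dom3_ldiv_g split: if_splits)

lemma dom_imp_pong_lmul_h: "dom1 v \<or> dom3 v \<Longrightarrow> pong p (lmul_h p v)"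
  using dom_imp_comparable[of v] comparable_imp_dom1[of "ldiv_c v" 1] comparable_imp_dom3[of "ldiv_c v" 1]
  by (simp add: pong_def lmul_h_def)

text \<open>The first column of \<open>cmat cyc_one\<close> spans the first axis, an eigenline of
  \<open>lmul_g\<close>, so no power of g moves the base point off that axis.\<close>

lemma dom1_ldiv_g_cyc_one: "dom1 ((ldiv_g ^^ k) cyc_one)"
  using q_g[of k "(ldiv_g ^^ k) cyc_one"] g_pos
  by (auto simp: dom1_def cyc_one_def zero_prod_def)

text \<open>Between the letters (p', k') and (p, k) the powers of g combine to exponent k' - k. If
  it is positive or negative, the comparable point moves into \<open>dom1\<close> or
  \<open>dom3\<close>, from where \<open>lmul_h p\<close> throws it into its own set; if it is zero,
  reducedness forces p' = p and the point stays in that set.\<close>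

lemma fold_nine_pong:
  assumes "reduced_word (w @ [(p, k)])"
  shows "\<exists>z. pong p z \<and> fold nine (w @ [(p, k)]) cyc_one = (lmul_g ^^ k) z"
  using assms
proof (induction w arbitrary: p k rule: rev_induct)
  case Nil
  show ?case
    by (intro exI[of _ "lmul_h p ((ldiv_g ^^ k) cyc_one)"]) (simp add: dom_imp_pong_lmul_h dom1_ldiv_g_cyc_one)
next
  case (snoc l w)
  obtain p' k' where l: "l = (p', k')" by (cases l)
  have red: "reduced_word (w @ [(p', k')])" "(p, k) \<noteq> (\<not> p', k')"
    using snoc.prems reduced_word_append[of "w @ [l]" "[(p, k)]"] by (auto simp: l)
  obtain z' where z': "pong p' z'" "fold nine (w @ [l]) cyc_one = (lmul_g ^^ k') z'"
    using snoc.IH[OF red(1)] unfolding l by blast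
  define y where "y = (ldiv_g ^^ k) ((lmul_g ^^ k') z')"
  have "pong p (lmul_h p y)"
  proof (cases k k' rule: linorder_cases)
    case less
    then obtain m where m: "k' = k + m" "m > 0" by (metis less_imp_add_positive)
    then have "y = (lmul_g ^^ m) z'" by (simp add: y_def funpow_add)
    with m z' show ?thesis
      using comparable_imp_dom1[of z' m] pong_imp_comparable dom_imp_pong_lmul_h by blast
  next
    case equal
    then have "p' = p" using red(2) by simp
    with equal z' show ?thesis by (simp add: y_def pong_lmul_h)
  next
    case greater
    then obtain m where m: "k = m + k'" "m > 0" by (metis add.commute less_imp_add_positive)
    then have "y = (ldiv_g ^^ m) z'" by (simp add: y_def funpow_add)
    with m z' show ?thesis
      using comparable_imp_dom3[of z' m] pong_imp_comparable dom_imp_pong_lmul_h by blast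
  qed
  then show ?case using z'(2) by (intro exI[of _ "lmul_h p y"]) (simp add: y_def)
qed

text \<open>A word with a nonzero fixed vector fixes 1, which would place \<open>z\<close> both in
  \<open>dom1\<close> and in the disjoint set \<open>pong p\<close>.\<close>

lemma nine_free:
  assumes "reduced_word w" "w \<noteq> []" "fold nine w v = v"
  shows "v = 0"
proof (rule ccontr)
  assume "v \<noteq> 0"
  obtain u p k where w: "w = u @ [(p, k)]"
    using assms(2) by (metis append_butlast_last_id prod.exhaust)
  obtain z where z: "pong p z" "fold nine w cyc_one = (lmul_g ^^ k) z"
    using fold_nine_pong assms(1) unfolding w by blast
  have "(ldiv_g ^^ k) cyc_one = (ldiv_g ^^ k) ((lmul_g ^^ k) z)"
    using fold_nine_fixed[OF assms(3) \<open>v \<noteq> 0\<close>] z(2) by simp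
  then have "dom1 z" using dom1_ldiv_g_cyc_one[of k] by simp
  then show False using z(1) dom_not_pong by blast
qed

section \<open>Free actions on integer vectors\<close>

fun nth9 :: "cyc \<Rightarrow> nat \<Rightarrow> int" where
  "nth9 ((a, b, c), (d, e, f), (g, h, i)) j = [a, b, c, d, e, f, g, h, i] ! j"

definition pack9 :: "(nat \<Rightarrow> int) \<Rightarrow> cyc" where
  "pack9 f = ((f 0, f 1, f 2), (f 3, f 4, f 5), (f 6, f 7, f 8))"

lemma pack9_nth9: "pack9 (nth9 v) = v"
  by (cases v) (auto simp: pack9_def)

lemma pack9_cong: "(\<And>j. j < 9 \<Longrightarrow> f j = g j) \<Longrightarrow> pack9 f = pack9 g"
  by (simp add: pack9_def)

lemma pack9_eqD: "pack9 f = pack9 g \<Longrightarrow> j < 9 \<Longrightarrow> f j = g j"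
proof -
  assume "pack9 f = pack9 g" "j < 9"
  moreover from this have "j = 0 \<or> j = 1 \<or> j = 2 \<or> j = 3 \<or> j = 4 \<or> j = 5 \<or> j = 6 \<or> j = 7 \<or> j = 8"
    by arith
  ultimately show "f j = g j" by (auto simp: pack9_def)
qed

lemma pack9_add: "pack9 (\<lambda>j. f j + g j) = pack9 f + pack9 g"
  by (simp add: pack9_def)

lemma pack9_0: "pack9 (\<lambda>j. 0) = 0"
  by (simp add: pack9_def zero_prod_def)

text \<open>Even dimensions consist of 2-dimensional blocks only; odd ones also contain one block of dimension 9,
  which is why 3, 5, 7 and 9 are excluded.\<close>

lemma exists_letters:
  assumes "CARD('n :: finite) \<ge> 2" "CARD('n) \<notin> {3, 5, 7, 9}"
  obtains T :: "bool \<times> nat \<Rightarrow> int ^ 'n \<Rightarrow> int ^ 'n" and v0 i0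
  where "free_letters T" "\<And>l v w. T l (v + w) = T l v + T l w" "v0 = axis i0 1"
    "\<And>k. T (True, Suc k) v0 - T (True, k) v0 = v0 + v0 + v0"
proof -
  define d where "d = CARD('n)"
  obtain e :: "'n \<Rightarrow> nat" where e: "bij_betw e UNIV {..<d}"
    using finite_same_card_bij[of "UNIV :: 'n set" "{..<d}"] unfolding d_def card_lessThan
    by (metis finite finite_lessThan)
  define e' where "e' = inv_into UNIV e"
  have e'e [simp]: "e' (e i) = i" for i
    using e by (simp add: e'_def bij_betw_def)
  have ee' [simp]: "e (e' j) = j" if "j < d" for j
    using e that unfolding e'_def bij_betw_def by (metis f_inv_into_f lessThan_iff)
  have e_less: "e i < d" for i
    using e by (auto simp: bij_betw_def)
  \<comment> \<open>The block of dimension 9, if present, fills the first \<open>b\<close>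
    positions; plane blocks fill the rest.\<close>
  define b :: nat where "b = (if even d then 0 else 9)"
  have b: "b \<in> {0, 9}" "b + 2 \<le> d" "even (d - b)"
  proof -
    have "d \<ge> 2" "d \<noteq> 3" "d \<noteq> 5" "d \<noteq> 7" "d \<noteq> 9"
      using assms by (simp_all add: d_def)
    then have "odd d \<Longrightarrow> 11 \<le> d" by presburger
    then show "b \<in> {0, 9}" "b + 2 \<le> d" "even (d - b)"
      using assms by (auto simp: b_def d_def[symmetric])
  qed
  define P where "P v = pack9 (\<lambda>j. v $ e' j)" for v :: "int ^ 'n"
  define B where "B m v = (v $ e' (b + 2 * m), v $ e' (b + 2 * m + 1))" for m and v :: "int ^ 'n"
  \<comment> \<open>A vector is determined by its blocks, so every property of \<open>T\<close> can
    be checked block by block.\<close>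
  have ext: "v = w" if "b = 9 \<Longrightarrow> P v = P w" "\<And>m. b + 2 * m + 1 < d \<Longrightarrow> B m v = B m w" for v w
  proof -
    have "v $ i = w $ i" for i
    proof (cases "e i < b")
      case True
      then have "b = 9" using b(1) by auto
      with pack9_eqD[OF that(1)[unfolded P_def], of "e i"] True show ?thesis by simp
    next
      case False
      define m where "m = (e i - b) div 2"
      have m: "e i = b + 2 * m \<or> e i = b + 2 * m + 1" using False by (auto simp: m_def)
      moreover obtain n where "d - b = 2 * n" using b(3) by (rule evenE)
      ultimately have "m < n" "d = b + 2 * n" using e_less[of i] b(2) by auto
      then have "b + 2 * m + 1 < d" by simp
      then have "B m v = B m w" by (rule that(2))
      moreover have "i = e' (b + 2 * m) \<or> i = e' (b + 2 * m + 1)"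
        using m e'e[of i] by metis
      ultimately show ?thesis by (auto simp: B_def)
    qed
    then show ?thesis by (simp add: vec_eq_iff)
  qed
  define T where "T l v = (\<chi> i. if e i < b then nth9 (nine l (P v)) (e i)
    else (if even (e i - b) then fst else snd) (plane l (B ((e i - b) div 2) v)))" for l v
  have P_T: "P (T l v) = nine l (P v)" if "b = 9" for l v
  proof -
    have "pack9 (\<lambda>j. T l v $ e' j) = pack9 (nth9 (nine l (P v)))"
      by (rule pack9_cong) (use that b(2) in \<open>simp add: T_def\<close>)
    then show ?thesis by (simp add: P_def[of "T l v"] pack9_nth9)
  qed
  have B_T: "B m (T l v) = plane l (B m v)" if "b + 2 * m + 1 < d" for m l v
    using that unfolding B_def[of m "T l v"] by (simp add: T_def)
  have P_fold: "P (fold T w v) = fold nine w (P v)" if "b = 9" for w v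
    by (induction w arbitrary: v) (simp_all add: P_T[OF that])
  have B_fold: "B m (fold T w v) = fold plane w (B m v)" if "b + 2 * m + 1 < d" for m w v
    by (induction w arbitrary: v) (simp_all add: B_T[OF that])
  have P_add: "P (v + w) = P v + P w" for v w
    by (simp add: P_def pack9_add)
  have B_add: "B m (v + w) = B m v + B m w" for m v w
    by (simp add: B_def)
  have P_0: "P 0 = 0" by (simp add: P_def pack9_0)
  have B_0: "B m 0 = 0" for m by (simp add: B_def zero_prod_def)
  \<comment> \<open>The first basis vector of the first plane block. It vanishes on all other
    blocks, where the linear relation therefore reads 0 = 0.\<close>
  define v0 :: "int ^ 'n" where "v0 = axis (e' b) 1"
  show thesis
  proof
    show "free_letters T"
    proof
      fix l v show "T (inv_letter l) (T l v) = v"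
        by (rule ext) (simp_all add: P_T B_T nine.inv plane.inv)
    next
      fix w v assume w: "reduced_word w" "w \<noteq> []" "fold T w v = v"
      show "v = 0"
      proof (rule ext)
        assume "b = 9"
        then have "fold nine w (P v) = P v" using P_fold[of w v] w(3) by simp
        then show "P v = P 0" using nine_free[OF w(1,2)] by (simp add: P_0)
      next
        fix m assume "b + 2 * m + 1 < d"
        then have "fold plane w (B m v) = B m v" using B_fold[of m w v] w(3) by simp
        then show "B m v = B m 0" using plane.free[OF w(1,2)] by (simp add: B_0)
      qed
    qed
    show "T l (v + w) = T l v + T l w" for l v w
      by (rule ext) (simp_all add: P_T B_T P_add B_add nine_add plane_add)
    show "v0 = axis (e' b) 1" by (rule v0_def)
    fix k
    have P_v0: "P v0 = 0" if "b = 9"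
    proof -
      have "P v0 = pack9 (\<lambda>j. 0)"
        unfolding P_def v0_def
      proof (rule pack9_cong)
        fix j :: nat assume "j < 9"
        then have "e (e' b) \<noteq> e (e' j)" using that b(2) by simp
        then show "axis (e' b) 1 $ e' j = (0 :: int)" by (auto simp: axis_def)
      qed
      then show ?thesis by (simp add: pack9_0)
    qed
    have B_v0: "B m v0 = (if m = 0 then (1, 0) else 0)" if "b + 2 * m + 1 < d" for m
    proof -
      have "e' j = e' b \<longleftrightarrow> j = b" if "j < d" for j
        using that b(2) ee' by (metis add_leD1 less_le_trans less_add_same_cancel1 zero_less_numeral)
      then show ?thesis using that by (auto simp: B_def v0_def axis_def zero_prod_def)
    qed
    have nine_0: "nine l 0 = 0" for l using nine_add[of l 0 0] by simp
    have plane_0: "plane l 0 = 0" for l using plane_add[of l 0 0] by simp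
    have "T (True, Suc k) v0 = T (True, k) v0 + (v0 + v0 + v0)"
    proof (rule ext)
      assume "b = 9"
      then show "P (T (True, Suc k) v0) = P (T (True, k) v0 + (v0 + v0 + v0))"
        unfolding P_add P_T[OF \<open>b = 9\<close>] P_v0[OF \<open>b = 9\<close>] nine_0 by simp
    next
      fix m assume "b + 2 * m + 1 < d"
      then show "B m (T (True, Suc k) v0) = B m (T (True, k) v0 + (v0 + v0 + v0))"
        unfolding B_add B_T[OF \<open>b + 2 * m + 1 < d\<close>] B_v0[OF \<open>b + 2 * m + 1 < d\<close>]
        by (cases "m = 0") (simp_all add: plane_0 del: plane.simps, simp)
    qed
    then show "T (True, Suc k) v0 - T (True, k) v0 = v0 + v0 + v0" by simp
  qed
qed

section \<open>Characters and linear maps of the torus\<close>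

lemma to_torus_rep_torus [simp]: "to_torus (rep_torus t) = t"
  by (rule Quotient_abs_rep[OF Quotient_torus])

lemma to_torus_cases: obtains x where "t = to_torus x"
  using that[of "rep_torus t"] by simp

lemma continuous_on_torus_iff:
  fixes f :: "'n :: finite torus \<Rightarrow> 'b :: topological_space"
  shows "continuous_on UNIV f \<longleftrightarrow> continuous_on UNIV (\<lambda>x. f (to_torus x))"
  by (simp add: continuous_on_open_vimage open_torus_def vimage_def)

definition chr :: "int ^ 'n \<Rightarrow> 'n :: finite torus \<Rightarrow> complex"
  where "chr k t = cis (2 * pi * (\<Sum>i\<in>UNIV. of_int (k $ i) * rep_torus t $ i))"

lemma chr_to_torus: "chr k (to_torus x) = cis (2 * pi * (\<Sum>i\<in>UNIV. of_int (k $ i) * x $ i))"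
proof -
  let ?y = "rep_torus (to_torus x)"
  have "?y - x \<in> int_lattice"
    by (metis to_torus_eq_iff to_torus_rep_torus)
  then have "(\<Sum>i\<in>UNIV. of_int (k $ i) * (?y - x) $ i) \<in> \<int>"
    by (intro Ints_sum) (auto simp: int_lattice_def)
  then have "cis (2 * pi * (\<Sum>i\<in>UNIV. of_int (k $ i) * (?y - x) $ i)) = 1"
    by (rule cis_multiple_2pi)
  then show ?thesis
    unfolding chr_def
    by (simp add: right_diff_distrib sum_subtractf cis_divide[symmetric])
qed

lemma chr_add: "chr (k + l) t = chr k t * chr l t"
  by (simp add: chr_def cis_mult distrib_left distrib_right sum.distrib)

lemma chr_0 [simp]: "chr 0 t = 1"
  by (simp add: chr_def)

lemma chr_minus: "chr (- k) t = cnj (chr k t)"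
  by (simp add: chr_def cis_cnj sum_negf)

lemma norm_chr [simp]: "norm (chr k t) = 1"
  by (simp add: chr_def)

lemma chr_nonzero [simp]: "chr k t \<noteq> 0"
  using norm_chr[of k t] by force

lemma chr_torus_add: "chr k (s + t) = chr k s * chr k t"
  by (cases s rule: to_torus_cases; cases t rule: to_torus_cases)
    (simp add: to_torus_add[symmetric] chr_to_torus cis_mult distrib_left sum.distrib)

lemma continuous_chr: "continuous_on UNIV (chr k)"
  unfolding continuous_on_torus_iff chr_to_torus by (intro continuous_intros)

lemma chr_separates: "s \<noteq> t \<Longrightarrow> \<exists>k. chr k s \<noteq> chr k t"
proof -
  obtain x y where xy: "s = to_torus x" "t = to_torus y" by (metis to_torus_rep_torus)
  assume "s \<noteq> t"
  then obtain i where i: "x $ i - y $ i \<notin> \<int>"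
    by (auto simp: xy to_torus_eq_iff int_lattice_def)
  have eq: "chr (axis i 1) (to_torus z) = cis (2 * pi * z $ i)" for z
    by (simp add: chr_to_torus axis_def if_distrib[of of_int] if_distrib[of "\<lambda>a. a * _"] cong: if_cong)
  have "chr (axis i 1) s \<noteq> chr (axis i 1) t"
  proof
    assume "chr (axis i 1) s = chr (axis i 1) t"
    then have "cis (2 * pi * (x $ i - y $ i)) = 1"
      by (simp add: xy eq cis_divide[symmetric] right_diff_distrib)
    then have "cos (2 * pi * (x $ i - y $ i)) = 1"
      by (metis cis.sel(1) one_complex.sel(1))
    then show False using i by (auto simp: cos_one_2pi_int)
  qed
  then show ?thesis by blast
qed

text \<open>Turns identities between maps of the torus into identities between their duals on
  integer vectors.\<close>

lemma torus_eqI: "(\<And>k. chr k s = chr k t) \<Longrightarrow> s = t"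
  using chr_separates by blast

lemma chr_nontrivial: "k \<noteq> 0 \<Longrightarrow> \<exists>t. chr k t \<noteq> 1"
proof -
  assume "k \<noteq> 0"
  then obtain i where i: "k $ i \<noteq> 0" by (auto simp: vec_eq_iff)
  \<comment> \<open>Chosen so that the character takes the value -1 there.\<close>
  define x where "x = (axis i (1 / (2 * of_int (k $ i))) :: real ^ 'a)"
  have "(\<Sum>j\<in>UNIV. of_int (k $ j) * x $ j) = of_int (k $ i) * (1 / (2 * of_int (k $ i)))"
    by (simp add: x_def axis_def if_distrib[of "\<lambda>a. _ * a"] cong: if_cong)
  also have "\<dots> = 1 / 2" using i by simp
  finally have eq: "(\<Sum>j\<in>UNIV. of_int (k $ j) * x $ j) = 1 / 2" .
  have "chr k (to_torus x) = cis pi" unfolding chr_to_torus eq by simp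
  then show ?thesis by (intro exI[of _ "to_torus x"]) simp
qed

text \<open>\<open>T\<close> acts on characters, so \<open>tmap\<close> reverses the order of composition.\<close>

definition tmap :: "(int ^ 'n \<Rightarrow> int ^ 'n) \<Rightarrow> 'n :: finite torus \<Rightarrow> 'n torus"
  where "tmap T t = to_torus (\<chi> i. \<Sum>j\<in>UNIV. of_int (T (axis i 1) $ j) * rep_torus t $ j)"

lemma tmap_to_torus: "tmap T (to_torus x) = to_torus (\<chi> i. \<Sum>j\<in>UNIV. of_int (T (axis i 1) $ j) * x $ j)"
proof -
  have "rep_torus (to_torus x) - x \<in> int_lattice"
    by (metis to_torus_eq_iff to_torus_rep_torus)
  then have "(\<Sum>j\<in>UNIV. of_int (T (axis i 1) $ j) * (rep_torus (to_torus x) - x) $ j) \<in> \<int>" for i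
    by (intro Ints_sum) (auto simp: int_lattice_def)
  then show ?thesis
    by (simp add: tmap_def to_torus_eq_iff int_lattice_def right_diff_distrib sum_subtractf)
qed

lemma additive_scale:
  fixes T :: "int ^ 'n \<Rightarrow> int ^ 'm"
  assumes "Modules.additive T"
  shows "T (c *s v) = c *s T v"
proof (induction c rule: int_induct[where k = 0])
  case base
  then show ?case by (simp add: Modules.additive.zero[OF assms])
next
  case (step1 i)
  then show ?case by (simp add: Modules.additive.add[OF assms] vector_sadd_rdistrib)
next
  case (step2 i)
  then show ?case by (simp add: Modules.additive.diff[OF assms] vector_ssub_ldistrib vector_sub_rdistrib)
qed

lemma chr_tmap:
  assumes "Modules.additive T"
  shows "chr k (tmap T t) = chr (T k) t"
proof -
  obtain x where t: "t = to_torus x" by (rule to_torus_cases)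
  have "T k = T (\<Sum>i\<in>UNIV. (k $ i) *s axis i 1)"
    by (simp only: basis_expansion)
  also have "\<dots> = (\<Sum>i\<in>UNIV. (k $ i) *s T (axis i 1))"
    by (simp only: Modules.additive.sum[OF assms] additive_scale[OF assms])
  finally have "T k $ j = (\<Sum>i\<in>UNIV. k $ i * T (axis i 1) $ j)" for j
    by simp
  then have "(\<Sum>j\<in>UNIV. of_int (T k $ j) * x $ j) =
      (\<Sum>j\<in>UNIV. \<Sum>i\<in>UNIV. of_int (k $ i) * (of_int (T (axis i 1) $ j) * x $ j))"
    by (simp add: sum_distrib_right mult.assoc)
  also have "\<dots> = (\<Sum>i\<in>UNIV. of_int (k $ i) * (\<Sum>j\<in>UNIV. of_int (T (axis i 1) $ j) * x $ j))"
    by (subst sum.swap) (simp add: sum_distrib_left)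
  finally show ?thesis by (simp add: t tmap_to_torus chr_to_torus)
qed

lemma tmap_add: "tmap T (s + t) = tmap T s + tmap T t"
  by (cases s rule: to_torus_cases; cases t rule: to_torus_cases)
    (simp add: to_torus_add[symmetric] tmap_to_torus distrib_left sum.distrib vec_eq_iff plus_vec_def)

lemma continuous_tmap: "continuous_on UNIV (tmap T)"
  unfolding continuous_on_torus_iff tmap_to_torus
  by (intro continuous_on_compose2[OF continuous_on_to_torus] continuous_intros) auto

section \<open>Haar measure and trigonometric polynomials\<close>

lemma sets_haar_borel [simp, measurable_cong]: "sets haar_borel = sets borel"
  and space_haar_borel [simp]: "space haar_borel = UNIV"
  by (simp_all add: haar_borel_def)

interpretation haar_borel: prob_space haar_borel
  by (rule prob_spaceI) (simp add: emeasure_haar_borel_UNIV)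

lemma measure_haar_borel_UNIV [simp]: "measure haar_borel UNIV = 1"
  by (simp add: measure_def emeasure_haar_borel_UNIV)

lemma torus_translate_measurable [measurable]: "(+) (a :: 'n :: finite torus) \<in> borel_measurable borel"
proof (rule borel_measurable_continuous_onI)
  obtain v where a: "a = to_torus v" by (rule to_torus_cases)
  show "continuous_on UNIV ((+) a)"
    unfolding continuous_on_torus_iff a to_torus_add[symmetric]
    by (intro continuous_on_compose2[OF continuous_on_to_torus] continuous_intros) auto
qed

lemma chr_measurable [measurable]: "chr k \<in> borel_measurable borel"
  by (rule borel_measurable_continuous_onI[OF continuous_chr])

lemma tmap_measurable [measurable]: "tmap T \<in> borel_measurable borel"
  by (rule borel_measurable_continuous_onI[OF continuous_tmap])

lemma integral_chr: "(\<integral>t. chr k t \<partial>haar_borel) = (if k = 0 then 1 else 0)"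
proof (cases "k = 0")
  case True
  then show ?thesis by (simp add: measure_haar_borel_UNIV)
next
  case False
  then obtain a where a: "chr k a \<noteq> 1" using chr_nontrivial by blast
  have "(\<integral>t. chr k t \<partial>haar_borel) = (\<integral>t. chr k t \<partial>distr haar_borel borel ((+) a))"
    by (simp add: haar_borel_translate)
  also have "\<dots> = chr k a * (\<integral>t. chr k t \<partial>haar_borel)"
    by (simp add: integral_distr chr_torus_add)
  finally show ?thesis using a False by simp
qed

text \<open>Uniqueness of Haar measure: both sides are computed from the double integral of
  \<open>indicator A (s + tmap T t)\<close>.\<close>

lemma distr_tmap:
  assumes "surj (tmap T)"
  shows "distr haar_borel borel (tmap T) = haar_borel"
proof (rule measure_eqI)
  fix A :: "'a torus set" assume "A \<in> sets (distr haar_borel borel (tmap T))"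
  then have A [measurable]: "A \<in> sets borel" by simp
  \<comment> \<open>The double integral is pulled back to the fundamental cube, where joint
    measurability follows from continuity on a Euclidean product.\<close>
  define M where "M = restrict_space lborel (fund_cube :: (real ^ 'a) set)"
  have haar_eq: "haar_borel = distr M borel to_torus"
    by (simp add: haar_borel_def M_def)
  have M_to_torus [measurable]: "to_torus \<in> measurable M borel"
    unfolding M_def by (rule measurable_restrict_space1) simp
  interpret M: prob_space M
  proof (rule prob_spaceI)
    have "emeasure M (space M) = emeasure (distr M borel to_torus) UNIV"
      by (simp add: emeasure_distr)
    then show "emeasure M (space M) = 1"
      by (simp add: haar_eq[symmetric] emeasure_haar_borel_UNIV)
  qed
  interpret pair_sigma_finite M M ..
  let ?F = "\<lambda>x y. indicator A (to_torus x + tmap T (to_torus y)) :: ennreal"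
  have "continuous_on UNIV (\<lambda>p :: (real ^ 'a) \<times> (real ^ 'a).
      fst p + (\<chi> i. \<Sum>j\<in>UNIV. of_int (T (axis i 1) $ j) * snd p $ j))"
    by (intro continuous_intros)
  then have "continuous_on UNIV (\<lambda>p :: (real ^ 'a) \<times> (real ^ 'a).
      to_torus (fst p + (\<chi> i. \<Sum>j\<in>UNIV. of_int (T (axis i 1) $ j) * snd p $ j)))"
    by (rule continuous_on_compose2[OF continuous_on_to_torus]) auto
  then have "(\<lambda>p :: (real ^ 'a) \<times> (real ^ 'a). to_torus (fst p) + tmap T (to_torus (snd p))) \<in> borel_measurable borel"
    unfolding tmap_to_torus to_torus_add[symmetric] by (rule borel_measurable_continuous_onI)
  moreover have "(\<lambda>x. x) \<in> measurable M borel"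
    unfolding M_def by (rule measurable_restrict_space1) simp
  then have "(\<lambda>p. (fst p, snd p)) \<in> measurable (M \<Otimes>\<^sub>M M) (borel :: ((real ^ 'a) \<times> (real ^ 'a)) measure)"
    unfolding borel_prod[symmetric]
    by (intro measurable_Pair measurable_compose[OF measurable_fst] measurable_compose[OF measurable_snd])
  ultimately have [measurable]: "(\<lambda>p. to_torus (fst p) + tmap T (to_torus (snd p))) \<in> measurable (M \<Otimes>\<^sub>M M) borel"
    using measurable_compose[of "\<lambda>p. (fst p, snd p)" "M \<Otimes>\<^sub>M M" borel] by fastforce
  have eq: "(\<integral>\<^sup>+x. ?F x y \<partial>M) = emeasure haar_borel A" for y
  proof -
    let ?s = "tmap T (to_torus y)"
    have "(\<integral>\<^sup>+x. ?F x y \<partial>M) = (\<integral>\<^sup>+x. indicator A (?s + to_torus x) \<partial>M)"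
      by (simp add: add.commute)
    also have "\<dots> = (\<integral>\<^sup>+t. indicator A (?s + t) \<partial>haar_borel)"
      unfolding haar_eq by (subst nn_integral_distr) auto
    also have "\<dots> = (\<integral>\<^sup>+t. indicator A t \<partial>distr haar_borel borel ((+) ?s))"
      by (subst nn_integral_distr) auto
    finally show ?thesis by (simp add: haar_borel_translate)
  qed
  have eq': "(\<integral>\<^sup>+y. ?F x y \<partial>M) = emeasure (distr haar_borel borel (tmap T)) A" for x
  proof -
    \<comment> \<open>Surjectivity moves the translation inside \<open>tmap T\<close>, where
      invariance of Haar measure absorbs it.\<close>
    obtain b where b: "to_torus x = tmap T b" using assms by (metis surjD)
    have "(\<integral>\<^sup>+y. ?F x y \<partial>M) = (\<integral>\<^sup>+t. indicator A (tmap T (b + t)) \<partial>haar_borel)"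
      unfolding haar_eq by (subst nn_integral_distr) (auto simp: b tmap_add)
    also have "\<dots> = (\<integral>\<^sup>+t. indicator A (tmap T t) \<partial>distr haar_borel borel ((+) b))"
      by (subst nn_integral_distr) auto
    also have "\<dots> = (\<integral>\<^sup>+t. indicator A t \<partial>distr haar_borel borel (tmap T))"
      unfolding haar_borel_translate by (subst nn_integral_distr) auto
    finally show ?thesis by simp
  qed
  have "emeasure (distr haar_borel borel (tmap T)) A = (\<integral>\<^sup>+x. \<integral>\<^sup>+y. ?F x y \<partial>M \<partial>M)"
    unfolding eq' by (simp add: M.emeasure_space_1)
  also have "\<dots> = (\<integral>\<^sup>+y. \<integral>\<^sup>+x. ?F x y \<partial>M \<partial>M)"
    by (rule Fubini'[symmetric]) (simp add: split_beta')
  also have "\<dots> = emeasure haar_borel A"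
    unfolding eq by (simp add: M.emeasure_space_1)
  finally show "emeasure (distr haar_borel borel (tmap T)) A = emeasure haar_borel A" .
qed simp

section \<open>Density of trigonometric polynomials\<close>

inductive_set trig :: "('n :: finite torus \<Rightarrow> complex) set" where
  chr: "(\<lambda>t. c * chr k t) \<in> trig"
| add: "f \<in> trig \<Longrightarrow> g \<in> trig \<Longrightarrow> (\<lambda>t. f t + g t) \<in> trig"

lemma trig_const: "(\<lambda>t. c) \<in> trig"
  using trig.chr[of c 0] by simp

lemma trig_mult: "f \<in> trig \<Longrightarrow> g \<in> trig \<Longrightarrow> (\<lambda>t. f t * g t) \<in> trig"
proof (induction rule: trig.induct)
  case (chr c k)
  then show ?case
  proof (induction rule: trig.induct)
    case (chr c' k')
    have "(\<lambda>t. c * chr k t * (c' * chr k' t)) = (\<lambda>t. (c * c') * chr (k + k') t)"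
      by (simp add: chr_add fun_eq_iff)
    then show ?case by (simp only: trig.chr)
  next
    case (add f g)
    then show ?case using trig.add by (simp add: distrib_left)
  qed
next
  case (add f h)
  then show ?case using trig.add by (simp add: distrib_right)
qed

lemma continuous_trig: "f \<in> trig \<Longrightarrow> continuous_on UNIV f"
  by (induction rule: trig.induct) (auto intro!: continuous_intros continuous_chr)

lemma trig_measurable: "f \<in> trig \<Longrightarrow> f \<in> borel_measurable borel"
  by (rule borel_measurable_continuous_onI[OF continuous_trig])

lemma trig_bounded: "f \<in> trig \<Longrightarrow> \<exists>C > 0. \<forall>t. norm (f t) \<le> C"
proof (induction rule: trig.induct)
  case (chr c k)
  show ?case by (intro exI[of _ "norm c + 1"]) (auto simp: norm_mult add_nonneg_pos)
next
  case (add f g)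
  then obtain C D where "C > 0" "D > 0" "\<And>t. norm (f t) \<le> C" "\<And>t. norm (g t) \<le> D" by blast
  then show ?case
    by (intro exI[of _ "C + D"]) (auto intro: order_trans[OF norm_triangle_ineq] add_mono)
qed

text \<open>Stone-Weierstrass is applied to the real functions whose complexification is
  trigonometric. They separate points because real and imaginary parts of \<open>chr k\<close> are
  combinations of \<open>chr k\<close> and \<open>chr (- k)\<close>.\<close>

lemma trig_real_uniform_approx:
  fixes f :: "'n :: finite torus \<Rightarrow> real"
  assumes "continuous_on UNIV f" "e > 0"
  obtains g where "g \<in> trig" "\<And>t. norm (complex_of_real (f t) - g t) < e"
proof -
  define R where "R = {f :: 'n torus \<Rightarrow> real. (\<lambda>t. complex_of_real (f t)) \<in> trig}"
  interpret function_ring_on R UNIV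
  proof
    show "compact (UNIV :: 'n torus set)" by (rule compact_torus)
  next
    fix f assume "f \<in> R"
    then have "continuous_on UNIV (\<lambda>t. Re (complex_of_real (f t)))"
      unfolding R_def by (intro continuous_on_Re continuous_trig) simp
    then show "continuous_on UNIV f" by simp
  next
    fix f g assume "f \<in> R" "g \<in> R"
    then show "(\<lambda>x. f x + g x) \<in> R" "(\<lambda>x. f x * g x) \<in> R"
      using trig.add[of "\<lambda>t. complex_of_real (f t)"] trig_mult[of "\<lambda>t. complex_of_real (f t)"]
      by (simp_all add: R_def)
  next
    show "(\<lambda>_. c) \<in> R" for c by (simp add: R_def trig_const)
  next
    fix x y :: "'n torus" assume "x \<noteq> y"
    then obtain k where k: "chr k x \<noteq> chr k y" using chr_separates by blast
    have "(\<lambda>t. complex_of_real (Re (chr k t))) = (\<lambda>t. 1 / 2 * chr k t + 1 / 2 * chr (- k) t)"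
      by (simp add: fun_eq_iff chr_minus complex_eq_iff)
    then have Re: "(\<lambda>t. Re (chr k t)) \<in> R"
      unfolding R_def by (simp only: mem_Collect_eq) (intro trig.intros)
    have "(\<lambda>t. complex_of_real (Im (chr k t))) = (\<lambda>t. - \<i> / 2 * chr k t + \<i> / 2 * chr (- k) t)"
      by (simp add: fun_eq_iff chr_minus complex_eq_iff)
    then have Im: "(\<lambda>t. Im (chr k t)) \<in> R"
      unfolding R_def by (simp only: mem_Collect_eq) (intro trig.intros)
    have "Re (chr k x) \<noteq> Re (chr k y) \<or> Im (chr k x) \<noteq> Im (chr k y)"
      using k complex_eqI by blast
    then show "\<exists>f\<in>R. f x \<noteq> f y"
    proof
      assume "Re (chr k x) \<noteq> Re (chr k y)"
      then show ?thesis by (intro bexI[OF _ Re])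
    next
      assume "Im (chr k x) \<noteq> Im (chr k y)"
      then show ?thesis by (intro bexI[OF _ Im])
    qed
  qed
  obtain g where g: "g \<in> R" "\<And>t. \<bar>f t - g t\<bar> < e"
    using Stone_Weierstrass_basic[OF assms] by auto
  show thesis
  proof
    show "(\<lambda>t. complex_of_real (g t)) \<in> trig" using g(1) by (simp add: R_def)
    show "norm (complex_of_real (f t) - complex_of_real (g t)) < e" for t
      using g(2)[of t] by (metis norm_of_real of_real_diff)
  qed
qed

text \<open>Inner regularity descends from Lebesgue measure: a closed subset of the unit cube is
  compact, so its image in the torus is closed.\<close>

lemma haar_borel_inner_closed:
  assumes A: "A \<in> sets borel" and "e > 0"
  obtains K where "closed K" "K \<subseteq> A" "measure haar_borel (A - K) < e"
proof -
  define E where "E = to_torus -` A \<inter> cbox 0 (1 :: real ^ 'a)"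
  have "to_torus -` A \<in> sets borel"
    using measurable_sets[OF to_torus_borel A] by simp
  then have "E \<in> sets borel" by (auto simp: E_def)
  then have "E \<in> sets lebesgue" by simp
  then obtain C where C: "closed C" "C \<subseteq> E" "E - C \<in> lmeasurable" "emeasure lebesgue (E - C) < ennreal e"
    using sets_lebesgue_inner_closed[OF _ \<open>e > 0\<close>] by blast
  have "C = C \<inter> cbox 0 1" using C(2) by (auto simp: E_def)
  then have "compact C" using C(1) by (metis closed_Int_compact compact_cbox)
  then have "compact (to_torus ` C)"
    by (intro compact_continuous_image continuous_on_subset[OF continuous_on_to_torus]) auto
  then have K: "closed (to_torus ` C)" by (rule compact_imp_closed)
  show thesis
  proof
    show "closed (to_torus ` C)" by fact
    show "to_torus ` C \<subseteq> A" using C(2) by (auto simp: E_def)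
    have "A - to_torus ` C \<in> sets borel" using A K by auto
    then have "emeasure haar_borel (A - to_torus ` C)
        = emeasure lborel (to_torus -` (A - to_torus ` C) \<inter> fund_cube)"
      by (rule emeasure_haar_borel)
    also have "\<dots> \<le> emeasure lborel (E - C)"
      using \<open>E \<in> sets borel\<close> C(1)
      by (intro emeasure_mono) (auto simp: E_def fund_cube_def mem_box_cart less_imp_le)
    also have "\<dots> < ennreal e"
      using C(4) \<open>E \<in> sets borel\<close> C(1) by simp
    finally have "ennreal (measure haar_borel (A - to_torus ` C)) < ennreal e"
      by (simp only: haar_borel.emeasure_eq_measure)
    then show "measure haar_borel (A - to_torus ` C) < e"
      by (simp only: ennreal_less_iff[OF measure_nonneg])
  qed
qed

text \<open>Closed sets inside \<open>A\<close> and inside its complement nearly exhaust the torus.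
  A Urysohn function for them differs from the indicator only on two small sets and is uniformly
  close to a trigonometric polynomial; each of the three errors gets a third of
  \<open>e\<close>.\<close>

lemma trig_approx:
  assumes A: "A \<in> sets borel" and "e > 0"
  obtains g where "g \<in> trig" "(\<integral>t. norm (indicator A t - g t) \<partial>haar_borel) < e"
proof -
  have e3: "e / 3 > 0" using \<open>e > 0\<close> by simp
  obtain K where K: "closed K" "K \<subseteq> A" "measure haar_borel (A - K) < e / 3"
    by (rule haar_borel_inner_closed[OF A e3])
  obtain L where L: "closed L" "L \<subseteq> - A" "measure haar_borel (- A - L) < e / 3"
    by (rule haar_borel_inner_closed[OF borel_comp[OF A] e3])
  have "Hausdorff_space (euclidean :: 'a torus topology)"
    unfolding Hausdorff_space_def using hausdorff by (metis disjnt_def open_openin)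
  moreover have "compact_space (euclidean :: 'a torus topology)"
    using compact_torus by (simp add: compact_space_def)
  ultimately have "normal_space (euclidean :: 'a torus topology)"
    using compact_Hausdorff_or_regular_imp_normal_space by blast
  then obtain f :: "'a torus \<Rightarrow> real" where f: "continuous_map euclidean (top_of_set {0..1}) f" "f ` L \<subseteq> {0}" "f ` K \<subseteq> {1}"
    using Urysohn_lemma[of euclidean L K 0 1] K(1,2) L(1,2) by (auto simp: disjnt_def)
  then have "continuous_on UNIV f" and f01: "\<And>t. 0 \<le> f t \<and> f t \<le> 1"
    by (auto simp: continuous_map_in_subtopology Pi_iff image_subset_iff)
  then obtain g where g: "g \<in> trig" "\<And>t. norm (complex_of_real (f t) - g t) < e / 3"
    using trig_real_uniform_approx[of f "e / 3"] \<open>e > 0\<close> by auto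
  have meas [measurable]: "A - K \<in> sets borel" "- A - L \<in> sets borel" "g \<in> borel_measurable borel"
    using A K(1) L(1) trig_measurable[OF g(1)] by auto
  note A [measurable]
  let ?h = "\<lambda>t. indicat_real (A - K) t + indicat_real (- A - L) t + e / 3"
  have le: "norm (indicator A t - g t) \<le> ?h t" for t
  proof -
    have "norm (indicator A t - complex_of_real (f t)) \<le> indicat_real (A - K) t + indicat_real (- A - L) t"
    proof -
      have "indicator A t - complex_of_real (f t) = complex_of_real (indicat_real A t - f t)"
        by (simp add: indicator_def)
      then have "norm (indicator A t - complex_of_real (f t)) = \<bar>indicat_real A t - f t\<bar>"
        by (simp only: norm_of_real)
      then show ?thesis
        using f01[of t] f(2,3) K(2) L(2) by (auto simp: indicator_def image_subset_iff)
    qed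
    then show ?thesis
      using norm_triangle_ineq[of "indicator A t - complex_of_real (f t)" "complex_of_real (f t) - g t"] g(2)[of t]
      by simp
  qed
  obtain C where C: "\<And>t. norm (g t) \<le> C" using trig_bounded[OF g(1)] by blast
  have "norm (indicator A t - g t) \<le> 1 + C" for t
    using norm_triangle_ineq4[of "indicator A t" "g t"] C[of t] by (auto simp: indicator_def split: if_splits)
  then have "integrable haar_borel (\<lambda>t. norm (indicator A t - g t))"
    by (intro haar_borel.integrable_const_bound[of _ "1 + C"]) auto
  moreover have int: "integrable haar_borel (indicat_real (A - K))" "integrable haar_borel (indicat_real (- A - L))"
    by (intro integrable_real_indicator; simp add: haar_borel.emeasure_eq_measure)+
  then have "integrable haar_borel ?h" by simp
  ultimately have "(\<integral>t. norm (indicator A t - g t) \<partial>haar_borel) \<le> (\<integral>t. ?h t \<partial>haar_borel)"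
    using le by (intro integral_mono) auto
  also have "\<dots> = measure haar_borel (A - K) + measure haar_borel (- A - L) + e / 3"
    using int by simp
  also have "\<dots> < e" using K(3) L(3) by simp
  finally show thesis using g(1) that by blast
qed

lemma integrable_bounded:
  fixes f :: "'n :: finite torus \<Rightarrow> complex"
  assumes "f \<in> borel_measurable borel" "\<And>t. norm (f t) \<le> C"
  shows "integrable haar_borel f"
  by (rule haar_borel.integrable_const_bound[of _ C]) (use assms in auto)

lemma integrable_trig: "f \<in> trig \<Longrightarrow> integrable haar_borel f"
  using integrable_bounded trig_measurable trig_bounded by blast

lemma integral_indicator_complex:
  assumes "A \<in> sets borel"
  shows "(\<integral>t. (indicator A t :: complex) \<partial>haar_borel) = of_real (measure haar_borel A)"
proof -
  have "(\<integral>t. (indicator A t :: complex) \<partial>haar_borel) = (\<integral>t. of_real (indicat_real A t) \<partial>haar_borel)"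
    by (intro Bochner_Integration.integral_cong) (auto simp: indicator_def)
  then show ?thesis using assms by simp
qed

section \<open>A mixing criterion in terms of characters\<close>

locale torus_maps =
  fixes \<Gamma> :: "('n :: finite torus \<Rightarrow> 'n torus) set"
  assumes meas: "\<gamma> \<in> \<Gamma> \<Longrightarrow> \<gamma> \<in> borel_measurable borel"
    and preserving: "\<gamma> \<in> \<Gamma> \<Longrightarrow> distr haar_borel borel \<gamma> = haar_borel"
    and dual: "\<gamma> \<in> \<Gamma> \<Longrightarrow> \<exists>l. \<forall>t. chr k (\<gamma> t) = chr l t"
    and free: "l \<noteq> 0 \<Longrightarrow> finite {\<gamma> \<in> \<Gamma>. \<forall>t. chr l (\<gamma> t) = chr k t}"
begin

lemma integral_comp:
  fixes f :: "'n torus \<Rightarrow> 'b :: {banach, second_countable_topology}"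
  assumes "\<gamma> \<in> \<Gamma>" "f \<in> borel_measurable borel"
  shows "(\<integral>t. f (\<gamma> t) \<partial>haar_borel) = (\<integral>t. f t \<partial>haar_borel)"
proof -
  have "(\<integral>t. f t \<partial>distr haar_borel borel \<gamma>) = (\<integral>t. f (\<gamma> t) \<partial>haar_borel)"
    using meas[OF assms(1)] assms(2) by (intro integral_distr) auto
  then show ?thesis by (simp add: preserving[OF assms(1)])
qed

text \<open>By orthogonality, for nonzero \<open>l\<close> the left side can differ from 0 only if
  \<open>\<gamma>\<close> takes the character \<open>l\<close> to \<open>- k\<close>, and
  \<open>free\<close> leaves finitely many such maps.\<close>

lemma mixing_chr:
  "\<forall>\<^sub>F \<gamma> in inf cofinite (principal \<Gamma>). (\<integral>t. chr k t * chr l (\<gamma> t) \<partial>haar_borel) =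
    (\<integral>t. chr k t \<partial>haar_borel) * (\<integral>t. chr l t \<partial>haar_borel)"
proof (cases "l = 0")
  case False
  have eq: "(\<integral>t. chr k t * chr l (\<gamma> t) \<partial>haar_borel) = 0"
    if "\<gamma> \<in> \<Gamma>" "\<not> (\<forall>t. chr l (\<gamma> t) = chr (- k) t)" for \<gamma>
  proof -
    obtain l' where l': "\<And>t. chr l (\<gamma> t) = chr l' t" using dual \<open>\<gamma> \<in> \<Gamma>\<close> by blast
    with that have "k + l' \<noteq> 0" by (metis add_eq_0_iff)
    then show ?thesis by (simp add: l' chr_add[symmetric] integral_chr)
  qed
  show ?thesis
    unfolding eventually_inf_principal eventually_cofinite
    by (rule finite_subset[OF _ free[OF False, of "- k"]]) (use eq False in \<open>auto simp: integral_chr[of l]\<close>)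
qed simp

lemma mixing_trig:
  assumes "f \<in> trig" "g \<in> trig"
  shows "((\<lambda>\<gamma>. \<integral>t. f t * g (\<gamma> t) \<partial>haar_borel) \<longlongrightarrow> (\<integral>t. f t \<partial>haar_borel) * (\<integral>t. g t \<partial>haar_borel))
    (inf cofinite (principal \<Gamma>))"
  using assms
proof (induction rule: trig.induct)
  case (chr c k)
  then show ?case
  proof (induction rule: trig.induct)
    case (chr c' l)
    have *: "(\<lambda>t. c * chr k t * (c' * chr l (\<gamma> t))) = (\<lambda>t. c * c' * (chr k t * chr l (\<gamma> t)))" for \<gamma>
      by (simp add: fun_eq_iff)
    show ?case
      unfolding *
      by (rule tendsto_eventually, rule eventually_mono[OF mixing_chr[of k l]]) simp
  next
    case (add g h)
    let ?f = "\<lambda>t. c * chr k t"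
    have int: "integrable haar_borel (\<lambda>t. ?f t * g (\<gamma> t))" if "\<gamma> \<in> \<Gamma>" "g \<in> trig" for \<gamma> g
    proof -
      obtain C where C: "C > 0" "\<And>t. norm (g t) \<le> C" using trig_bounded \<open>g \<in> trig\<close> by blast
      show ?thesis
        using measurable_compose[OF meas[OF that(1)] trig_measurable[OF that(2)]] C
        by (intro integrable_bounded[of _ "norm c * C"]) (auto simp: norm_mult mult_left_mono)
    qed
    have "\<forall>\<^sub>F \<gamma> in inf cofinite (principal \<Gamma>). (\<integral>t. ?f t * g (\<gamma> t) \<partial>haar_borel) + (\<integral>t. ?f t * h (\<gamma> t) \<partial>haar_borel)
        = (\<integral>t. ?f t * (g (\<gamma> t) + h (\<gamma> t)) \<partial>haar_borel)"
      unfolding eventually_inf_principal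
      by (rule always_eventually)
        (use add int in \<open>simp add: distrib_left\<close>)
    moreover have "(\<integral>t. g t + h t \<partial>haar_borel) = (\<integral>t. g t \<partial>haar_borel) + (\<integral>t. h t \<partial>haar_borel)"
      using add by (intro Bochner_Integration.integral_add integrable_trig)
    ultimately show ?case
      using tendsto_add[OF add.IH] by (auto simp: distrib_left elim!: Lim_transform_eventually)
  qed
next
  case (add f h)
  have int: "integrable haar_borel (\<lambda>t. f t * g (\<gamma> t))" if \<gamma>: "\<gamma> \<in> \<Gamma>" and f: "f \<in> trig" for \<gamma> f
  proof -
    obtain C where C: "C > 0" "\<And>t. norm (g t) \<le> C" using trig_bounded add.prems by blast
    obtain D where D: "D > 0" "\<And>t. norm (f t) \<le> D" using trig_bounded f by blast
    show ?thesis
      using measurable_compose[OF meas[OF \<gamma>] trig_measurable[OF add.prems]] trig_measurable[OF f] C D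
      by (intro integrable_bounded[of _ "D * C"]) (auto simp: norm_mult intro!: mult_mono)
  qed
  have "\<forall>\<^sub>F \<gamma> in inf cofinite (principal \<Gamma>). (\<integral>t. f t * g (\<gamma> t) \<partial>haar_borel) + (\<integral>t. h t * g (\<gamma> t) \<partial>haar_borel)
      = (\<integral>t. (f t + h t) * g (\<gamma> t) \<partial>haar_borel)"
    unfolding eventually_inf_principal
    by (rule always_eventually) (use add int in \<open>simp add: distrib_right\<close>)
  moreover have "(\<integral>t. f t + h t \<partial>haar_borel) = (\<integral>t. f t \<partial>haar_borel) + (\<integral>t. h t \<partial>haar_borel)"
    using add by (intro Bochner_Integration.integral_add integrable_trig)
  ultimately show ?case
    using tendsto_add[OF add.IH(1)[OF add.prems] add.IH(2)[OF add.prems]]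
    by (auto simp: distrib_right elim!: Lim_transform_eventually)
qed

lemma mixing_borel:
  assumes A: "A \<in> sets borel" and B: "B \<in> sets borel"
  shows "((\<lambda>\<gamma>. measure haar_borel (A \<inter> \<gamma> -` B)) \<longlongrightarrow> measure haar_borel A * measure haar_borel B)
    (inf cofinite (principal \<Gamma>))"
proof (rule tendstoI)
  fix e :: real assume "e > 0"
  obtain f where f: "f \<in> trig" "(\<integral>t. norm (indicator A t - f t) \<partial>haar_borel) < e / 5"
    using trig_approx[OF A, of "e / 5"] \<open>e > 0\<close> by (metis zero_less_divide_iff zero_less_numeral)
  obtain C where C: "C > 0" "\<And>t. norm (f t) \<le> C" using trig_bounded[OF f(1)] by blast
  \<comment> \<open>The polynomial for \<open>B\<close> is chosen after that for \<open>A\<close>: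
    in a b - f g = (a - f) b + f (b - g) its error is multiplied by the bound \<open>C\<close> of
    \<open>f\<close>.\<close>
  have "e / (5 * C) > 0" using \<open>e > 0\<close> \<open>C > 0\<close> by simp
  obtain g where g: "g \<in> trig" "(\<integral>t. norm (indicator B t - g t) \<partial>haar_borel) < e / (5 * C)"
    using trig_approx[OF B \<open>e / (5 * C) > 0\<close>] by blast
  let ?a = "\<lambda>t. indicator A t :: complex" and ?b = "\<lambda>t. indicator B t :: complex"
  let ?I = "\<lambda>h. \<integral>t. h t \<partial>haar_borel"
  note A [measurable] B [measurable]
  note [measurable] = trig_measurable[OF f(1)] trig_measurable[OF g(1)]
  obtain D where D: "D > 0" "\<And>t. norm (g t) \<le> D" using trig_bounded[OF g(1)] by blast
  have int [simp]: "integrable haar_borel ?a" "integrable haar_borel ?b"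
    "integrable haar_borel f" "integrable haar_borel g"
    using integrable_bounded[of ?a 1] integrable_bounded[of ?b 1] integrable_trig f(1) g(1)
    by (auto simp: indicator_def)
  have g': "C * ?I (\<lambda>t. norm (?b t - g t)) < e / 5"
    using g(2) \<open>C > 0\<close> by (simp add: field_simps)
  have Ia: "?I ?a = of_real (measure haar_borel A)" "?I ?b = of_real (measure haar_borel B)"
    by (simp_all only: integral_indicator_complex A B)
  have limit: "norm (?I f * ?I g - ?I ?a * ?I ?b) < 2 * e / 5"
  proof -
    have "?I f * ?I g - ?I ?a * ?I ?b = ?I f * ?I (\<lambda>t. g t - ?b t) + ?I (\<lambda>t. f t - ?a t) * ?I ?b"
      by (simp add: algebra_simps del: integral_indicator)
    also have "norm \<dots> \<le> norm (?I f) * norm (?I (\<lambda>t. g t - ?b t)) + norm (?I (\<lambda>t. f t - ?a t)) * norm (?I ?b)"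
      by (rule order_trans[OF norm_triangle_ineq]) (simp add: norm_mult)
    also have "\<dots> \<le> C * ?I (\<lambda>t. norm (?b t - g t)) + ?I (\<lambda>t. norm (?a t - f t)) * 1"
    proof (intro add_mono mult_mono)
      have "norm (?I f) \<le> ?I (\<lambda>t. norm (f t))" by (rule integral_norm_bound)
      also have "\<dots> \<le> C" by (intro haar_borel.integral_le_const) (auto simp: C)
      finally show "norm (?I f) \<le> C" .
      show "norm (?I (\<lambda>t. g t - ?b t)) \<le> ?I (\<lambda>t. norm (?b t - g t))"
        using integral_norm_bound[of haar_borel "\<lambda>t. g t - ?b t"] by (simp add: norm_minus_commute)
      show "norm (?I (\<lambda>t. f t - ?a t)) \<le> ?I (\<lambda>t. norm (?a t - f t))"
        using integral_norm_bound[of haar_borel "\<lambda>t. f t - ?a t"] by (simp add: norm_minus_commute)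
      show "norm (?I ?b) \<le> 1" unfolding Ia by (simp add: haar_borel.prob_le_1)
    qed (use C in auto)
    finally show ?thesis using f(2) g' by simp
  qed
  have approx: "norm (of_real (measure haar_borel (A \<inter> \<gamma> -` B)) - ?I (\<lambda>t. f t * g (\<gamma> t))) < 2 * e / 5"
    if "\<gamma> \<in> \<Gamma>" for \<gamma>
  proof -
    note [measurable] = meas[OF that]
    have int_b: "integrable haar_borel (\<lambda>t. ?b (\<gamma> t) - g (\<gamma> t))"
    proof (rule integrable_bounded[of _ "1 + D"])
      show "norm (?b (\<gamma> t) - g (\<gamma> t)) \<le> 1 + D" for t
        using norm_triangle_ineq4[of "?b (\<gamma> t)" "g (\<gamma> t)"] D(2)[of "\<gamma> t"]
        by (auto simp: indicator_def split: if_splits)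
    qed simp
    have "A \<inter> \<gamma> -` B \<in> sets borel" using measurable_sets[OF meas[OF that] B] A by simp
    then have "of_real (measure haar_borel (A \<inter> \<gamma> -` B)) = ?I (\<lambda>t. indicator (A \<inter> \<gamma> -` B) t :: complex)"
      by (simp only: integral_indicator_complex)
    also have "\<dots> = ?I (\<lambda>t. ?a t * ?b (\<gamma> t))"
      by (rule Bochner_Integration.integral_cong) (auto simp: indicator_def)
    also have "\<dots> - ?I (\<lambda>t. f t * g (\<gamma> t)) = ?I (\<lambda>t. ?a t * ?b (\<gamma> t) - f t * g (\<gamma> t))"
    proof (rule Bochner_Integration.integral_diff[symmetric])
      show "integrable haar_borel (\<lambda>t. ?a t * ?b (\<gamma> t))"
        by (rule integrable_bounded[of _ 1]) (auto simp: indicator_def)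
      show "integrable haar_borel (\<lambda>t. f t * g (\<gamma> t))"
        by (rule integrable_bounded[of _ "C * D"]) (auto simp: norm_mult C D intro!: mult_mono less_imp_le[OF C(1)])
    qed
    also have "norm \<dots> \<le> ?I (\<lambda>t. norm (?a t * ?b (\<gamma> t) - f t * g (\<gamma> t)))"
      by (rule integral_norm_bound)
    also have "\<dots> \<le> ?I (\<lambda>t. norm (?a t - f t) + C * norm (?b (\<gamma> t) - g (\<gamma> t)))"
    proof (rule integral_mono')
      show "integrable haar_borel (\<lambda>t. norm (?a t - f t) + C * norm (?b (\<gamma> t) - g (\<gamma> t)))"
        using int_b by simp
    next
      fix t
      have "?a t * ?b (\<gamma> t) - f t * g (\<gamma> t) = (?a t - f t) * ?b (\<gamma> t) + f t * (?b (\<gamma> t) - g (\<gamma> t))"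
        by (simp add: algebra_simps)
      also have "norm \<dots> \<le> norm (?a t - f t) * norm (?b (\<gamma> t)) + norm (f t) * norm (?b (\<gamma> t) - g (\<gamma> t))"
        by (rule order_trans[OF norm_triangle_ineq]) (simp add: norm_mult)
      also have "\<dots> \<le> norm (?a t - f t) * 1 + C * norm (?b (\<gamma> t) - g (\<gamma> t))"
        using C by (intro add_mono mult_mono) (auto simp: indicator_def)
      finally show "norm (?a t * ?b (\<gamma> t) - f t * g (\<gamma> t)) \<le> norm (?a t - f t) + C * norm (?b (\<gamma> t) - g (\<gamma> t))"
        by simp
    qed (use C in auto)
    also have "\<dots> = ?I (\<lambda>t. norm (?a t - f t)) + C * ?I (\<lambda>t. norm (?b (\<gamma> t) - g (\<gamma> t)))"
      using int_b by simp
    \<comment> \<open>Measure preservation makes the error independent of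
      \<open>\<gamma>\<close>.\<close>
    also have "?I (\<lambda>t. norm (?b (\<gamma> t) - g (\<gamma> t))) = ?I (\<lambda>t. norm (?b t - g t))"
      using that by (intro integral_comp[where f = "\<lambda>t. norm (?b t - g t)"]) auto
    finally show ?thesis using f(2) g' by simp
  qed
  have "\<forall>\<^sub>F \<gamma> in inf cofinite (principal \<Gamma>). dist (?I (\<lambda>t. f t * g (\<gamma> t))) (?I f * ?I g) < e / 5"
    using mixing_trig[OF f(1) g(1)] \<open>e > 0\<close> by (intro tendstoD) auto
  then show "\<forall>\<^sub>F \<gamma> in inf cofinite (principal \<Gamma>).
      dist (measure haar_borel (A \<inter> \<gamma> -` B)) (measure haar_borel A * measure haar_borel B) < e"
    unfolding eventually_inf_principal
  proof (rule eventually_mono, intro impI)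
    fix \<gamma> assume "\<gamma> \<in> \<Gamma> \<longrightarrow> dist (?I (\<lambda>t. f t * g (\<gamma> t))) (?I f * ?I g) < e / 5" "\<gamma> \<in> \<Gamma>"
    then have 1: "norm (?I (\<lambda>t. f t * g (\<gamma> t)) - ?I f * ?I g) < e / 5" by (simp add: dist_norm)
    let ?m = "complex_of_real (measure haar_borel (A \<inter> \<gamma> -` B))"
    have "norm (?m - ?I ?a * ?I ?b) \<le> norm (?m - ?I (\<lambda>t. f t * g (\<gamma> t)))
        + norm (?I (\<lambda>t. f t * g (\<gamma> t)) - ?I f * ?I g) + norm (?I f * ?I g - ?I ?a * ?I ?b)"
      by (rule order_trans[OF _ add_right_mono[OF norm_triangle_ineq]])
        (rule order_trans[OF _ norm_triangle_ineq], simp)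
    also have "\<dots> < e" using 1 approx[OF \<open>\<gamma> \<in> \<Gamma>\<close>] limit by simp
    finally have "norm (complex_of_real (measure haar_borel (A \<inter> \<gamma> -` B) - measure haar_borel A * measure haar_borel B)) < e"
      unfolding Ia by (simp only: of_real_diff of_real_mult)
    then show "dist (measure haar_borel (A \<inter> \<gamma> -` B)) (measure haar_borel A * measure haar_borel B) < e"
      unfolding norm_of_real dist_real_def .
  qed
qed

end

section \<open>The automorphism group\<close>

lemma measure_haar_Un:
  assumes "S \<in> sets borel" "N \<in> null_sets haar_borel" "X \<subseteq> N"
  shows "measure haar (S \<union> X) = measure haar_borel S"
proof -
  have "X \<in> null_sets haar"
    using assms(2,3) null_sets_completion_subset[of X N haar_borel] null_sets_completionI[of N haar_borel]
    by (simp add: haar_def)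
  moreover have "S \<in> sets haar"
    using assms(1) by (simp add: haar_def)
  ultimately have "emeasure haar (S \<union> X) = emeasure haar S"
    by (intro emeasure_Un_null_set)
  also have "\<dots> = emeasure haar_borel S"
    using assms(1) by (simp add: haar_def)
  finally show ?thesis by (simp add: measure_def)
qed

text \<open>Passing to Borel parts changes \<open>A\<close> and \<open>B\<close> by null sets, and
  measure-preserving preimages of null sets are null.\<close>

lemma (in torus_maps) mixing: "mixing \<Gamma>"
  unfolding mixing_def
proof (intro ballI)
  fix A B :: "'n torus set" assume "A \<in> sets haar" "B \<in> sets haar"
  then obtain S M M' S' N N' where A: "A = S \<union> M" "S \<in> sets borel" "M \<subseteq> M'" "M' \<in> null_sets haar_borel"
    and B: "B = S' \<union> N" "S' \<in> sets borel" "N \<subseteq> N'" "N' \<in> null_sets haar_borel"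
    unfolding haar_def by (auto elim!: sets_completionE)
  have "measure haar (A \<inter> \<gamma> -` B) = measure haar_borel (S \<inter> \<gamma> -` S')" if \<gamma>: "\<gamma> \<in> \<Gamma>" for \<gamma>
  proof -
    have sets: "\<gamma> -` X \<in> sets borel" if "X \<in> sets borel" for X
      using measurable_sets[OF meas[OF \<gamma>] that] by simp
    have "emeasure haar_borel (\<gamma> -` N') = emeasure (distr haar_borel borel \<gamma>) N'"
      using B(4) meas[OF \<gamma>] by (subst emeasure_distr) (auto simp: null_sets_def)
    then have "\<gamma> -` N' \<in> null_sets haar_borel"
      using B(4) sets by (auto simp: preserving[OF \<gamma>] null_sets_def)
    moreover have "A \<inter> \<gamma> -` B = (S \<inter> \<gamma> -` S') \<union> (A \<inter> \<gamma> -` B - S \<inter> \<gamma> -` S')"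
      using A(1) B(1) by blast
    moreover have "A \<inter> \<gamma> -` B - S \<inter> \<gamma> -` S' \<subseteq> M' \<union> \<gamma> -` N'"
      using A B by blast
    ultimately show ?thesis
      using measure_haar_Un[of "S \<inter> \<gamma> -` S'" "M' \<union> \<gamma> -` N'"] A(2,4) sets[OF B(2)]
      by (metis null_sets.Un sets.Int)
  qed
  then have "\<forall>\<^sub>F \<gamma> in inf cofinite (principal \<Gamma>). measure haar_borel (S \<inter> \<gamma> -` S') = measure haar (A \<inter> \<gamma> -` B)"
    unfolding eventually_inf_principal by (intro always_eventually) simp
  then have "((\<lambda>\<gamma>. measure haar (A \<inter> \<gamma> -` B)) \<longlongrightarrow> measure haar_borel S * measure haar_borel S')
      (inf cofinite (principal \<Gamma>))"
    by (rule Lim_transform_eventually[OF mixing_borel[OF A(2) B(2)]])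
  moreover have "measure haar A = measure haar_borel S" "measure haar B = measure haar_borel S'"
    unfolding A(1) B(1) using A B by (auto intro: measure_haar_Un)
  ultimately show "((\<lambda>\<gamma>. measure haar (A \<inter> \<gamma> -` B)) \<longlongrightarrow> measure haar A * measure haar B)
      (inf cofinite (principal \<Gamma>))" by simp
qed

text \<open>By invariance a point of \<open>U\<close> may be translated to the centre of the cube,
  where an open neighbourhood meets the open box in positive Lebesgue measure.\<close>

lemma measure_haar_open_pos:
  fixes U :: "'n :: finite torus set"
  assumes "open U" "U \<noteq> {}"
  shows "measure haar U > 0"
proof -
  obtain t where "t \<in> U" using assms(2) by blast
  define x :: "real ^ 'n" where "x = (\<chi> i. 1 / 2)"
  define a where "a = t - to_torus x"
  define V where "V = (+) a -` U"
  have U: "U \<in> sets borel" using assms(1) by simp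
  then have V: "V \<in> sets borel"
    using measurable_sets[OF torus_translate_measurable U] by (simp add: V_def)
  have "open (to_torus -` V)"
  proof -
    obtain v where v: "a = to_torus v" by (rule to_torus_cases)
    have "to_torus -` V = (+) v -` (to_torus -` U)"
      by (auto simp: V_def v to_torus_add)
    moreover have "open (to_torus -` U)" using assms(1) by (simp add: open_torus_def)
    ultimately show ?thesis by (simp add: open_vimage continuous_on_add continuous_on_id continuous_on_const)
  qed
  moreover have "x \<in> to_torus -` V \<inter> box 0 1"
    using \<open>t \<in> U\<close> by (auto simp: V_def a_def x_def mem_box_cart)
  ultimately have "\<not> negligible (to_torus -` V \<inter> box 0 1)"
    by (intro open_not_negligible) auto
  then have "emeasure lborel (to_torus -` V \<inter> box 0 1) \<noteq> 0"
    using \<open>open (to_torus -` V)\<close>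
    by (auto simp: negligible_iff_null_sets null_sets_def intro: null_sets_completionI)
  moreover have "emeasure lborel (to_torus -` V \<inter> box 0 1) \<le> emeasure lborel (to_torus -` V \<inter> fund_cube)"
    using \<open>open (to_torus -` V)\<close>
    by (intro emeasure_mono) (auto simp: fund_cube_def mem_box_cart less_imp_le)
  ultimately have "emeasure lborel (to_torus -` V \<inter> fund_cube) \<noteq> 0"
    by (metis le_zero_eq)
  then have "emeasure haar_borel V \<noteq> 0"
    using V by (simp add: emeasure_haar_borel)
  moreover have "emeasure haar_borel V = emeasure (distr haar_borel borel ((+) a)) U"
    using U by (simp add: emeasure_distr V_def)
  ultimately have "measure haar_borel U \<noteq> 0"
    by (simp add: haar_borel_translate haar_borel.emeasure_eq_measure)
  moreover have "measure haar U = measure haar_borel U"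
    using measure_haar_Un[OF U, of "{}" "{}"] by simp
  ultimately show ?thesis using measure_nonneg[of haar_borel U] by linarith
qed

lemma one_Aut_torus: "\<one>\<^bsub>Aut_torus\<^esub> = id"
  by (auto simp: Aut_torus_def AutoGroup_def BijGroup_def torus_group_def)

lemma chr_eq_imp_eq: "(\<And>t. chr k t = chr l t) \<Longrightarrow> k = l"
  using chr_nontrivial[of "k - l"] chr_add[of "k - l" l] by force

section \<open>The free group of torus automorphisms\<close>

locale torus_letters = free_letters T
  for T :: "bool \<times> nat \<Rightarrow> int ^ 'n :: finite \<Rightarrow> int ^ 'n" +
  fixes v0 i0
  assumes T_add: "T l (v + w) = T l v + T l w"
    and v0: "v0 = axis i0 1"
    and relation: "T (True, Suc k) v0 - T (True, k) v0 = v0 + v0 + v0"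
begin

text \<open>\<open>fold\<close> applies the first letter first and \<open>tmap\<close> reverses
  composition; the two reversals cancel, so concatenation becomes composition.\<close>

definition val :: "(bool \<times> nat) list \<Rightarrow> 'n torus \<Rightarrow> 'n torus"
  where "val w = tmap (fold T w)"

definition \<Gamma> :: "('n torus \<Rightarrow> 'n torus) set"
  where "\<Gamma> = range val"

lemma v0_nonzero: "v0 \<noteq> 0"
  by (simp add: v0 axis_eq_0_iff)

lemma additive_fold: "Modules.additive (fold T w)"
proof
  show "fold T w (v + v') = fold T w v + fold T w v'" for v v'
    by (induction w arbitrary: v v') (simp_all add: T_add)
qed

lemma chr_val: "chr k (val w t) = chr (fold T w k) t"
  unfolding val_def by (rule chr_tmap[OF additive_fold])

lemma val_append: "val (u @ w) = val u \<circ> val w"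
  by (intro ext torus_eqI) (simp add: chr_val)

lemma val_Nil: "val [] = id"
  by (intro ext torus_eqI) (simp add: chr_val)

lemma val_inv_word: "val (inv_word w) \<circ> val w = id" "val w \<circ> val (inv_word w) = id"
  by (intro ext torus_eqI; simp add: chr_val fold_inv_word fold_inv_word')+

lemma val_eq_iff: "val u = val w \<longleftrightarrow> (\<forall>k. fold T u k = fold T w k)"
proof
  assume eq: "val u = val w"
  have "chr (fold T u k) t = chr (fold T w k) t" for k t
    using chr_val[of k u t] chr_val[of k w t] eq by simp
  then show "\<forall>k. fold T u k = fold T w k" using chr_eq_imp_eq by blast
next
  assume "\<forall>k. fold T u k = fold T w k"
  then have "fold T u = fold T w" by blast
  then show "val u = val w" by (simp add: val_def)
qed

lemma val_inject:
  assumes "reduced_word u" "reduced_word w" "val u = val w"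
  shows "u = w"
  using fold_eq_imp_eq[OF assms(1,2) v0_nonzero] assms(3) by (simp add: val_eq_iff)

lemma \<Gamma>_cases:
  assumes "\<gamma> \<in> \<Gamma>"
  obtains w where "reduced_word w" "\<gamma> = val w"
proof -
  obtain u where u: "\<gamma> = val u" using assms by (auto simp: \<Gamma>_def)
  obtain w where "reduced_word w" "\<forall>v. fold T w v = fold T u v" using reduce by blast
  then show thesis using that[of w] u val_eq_iff by metis
qed

lemma val_Aut: "val w \<in> carrier Aut_torus"
  using val_inv_word[of w] o_bij[of "val (inv_word w)" "val w"]
  by (auto simp: mem_Aut_torus_iff val_def tmap_add continuous_tmap)

lemma inv_val: "inv\<^bsub>Aut_torus\<^esub> val w = val (inv_word w)"
  by (rule group.inv_equality[OF group_Aut_torus])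
    (simp_all add: mult_Aut_torus val_Aut val_inv_word one_Aut_torus)

lemma subgroup_\<Gamma>: "subgroup \<Gamma> Aut_torus"
proof (rule group.subgroupI[OF group_Aut_torus])
  show "\<Gamma> \<subseteq> carrier Aut_torus" "\<Gamma> \<noteq> {}"
    using val_Aut by (auto simp: \<Gamma>_def)
  show "inv\<^bsub>Aut_torus\<^esub> a \<in> \<Gamma>" if "a \<in> \<Gamma>" for a
    using that by (auto simp: \<Gamma>_def inv_val)
  show "a \<otimes>\<^bsub>Aut_torus\<^esub> b \<in> \<Gamma>" if "a \<in> \<Gamma>" "b \<in> \<Gamma>" for a b
    using that by (auto simp: \<Gamma>_def mult_Aut_torus val_Aut val_append[symmetric])
qed

abbreviation G where "G \<equiv> Aut_torus \<lparr>carrier := \<Gamma>\<rparr>"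

text \<open>Translates letters indexed by numbers into letters that are group elements, as
  \<open>word_val\<close> and \<open>free_basis\<close> expect.\<close>

definition lift_word :: "(bool \<times> nat) list \<Rightarrow> (bool \<times> ('n torus \<Rightarrow> 'n torus)) list"
  where "lift_word w = map (\<lambda>(p, k). (p, val [(True, k)])) w"

lemma word_val_lift_word: "word_val G (lift_word w) = val w"
proof (induction w)
  case Nil
  then show ?case by (simp add: word_val_def lift_word_def one_Aut_torus val_Nil)
next
  case (Cons l w)
  obtain p k where l: "l = (p, k)" by (cases l)
  have "val [(True, k)] \<in> \<Gamma>" by (simp add: \<Gamma>_def)
  then have "inv\<^bsub>G\<^esub> val [(True, k)] = val [(False, k)]"
    using group.m_inv_consistent[OF group_Aut_torus subgroup_\<Gamma>] inv_val[of "[(True, k)]"]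
    by (simp add: inv_word_def)
  then have "word_val G (lift_word (l # w)) = val [l] \<otimes>\<^bsub>Aut_torus\<^esub> word_val G (lift_word w)"
    by (simp add: word_val_def lift_word_def l)
  then show ?case
    using Cons.IH val_append[of "[l]" w] by (simp add: mult_Aut_torus val_Aut)
qed

lemma val_letter_inject: "val [(True, j)] = val [(True, k)] \<longleftrightarrow> j = k"
  using val_inject[of "[(True, j)]" "[(True, k)]"] by (auto simp: reduced_word_Cons)

lemma reduced_lift_word: "reduced_word (lift_word w) \<longleftrightarrow> reduced_word w"
  by (auto simp: reduced_word_def lift_word_def successively_map split_beta val_letter_inject
      intro!: arg_cong2[where f = successively] ext)

lemma free_basis_G: "free_basis G (range (\<lambda>k. val [(True, k)]))"
  unfolding free_basis_def
proof (intro conjI ballI)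
  let ?S = "range (\<lambda>k. val [(True, k)])"
  show "?S \<subseteq> carrier G" by (auto simp: \<Gamma>_def)
  fix g assume "g \<in> carrier G"
  then obtain w where w: "reduced_word w" "g = val w" using \<Gamma>_cases by auto
  show "\<exists>!w. w \<in> lists (UNIV \<times> ?S) \<and> reduced_word w \<and> word_val G w = g"
  proof (intro ex1I conjI)
    show "lift_word w \<in> lists (UNIV \<times> ?S)" by (auto simp: lift_word_def)
    show "reduced_word (lift_word w)" "word_val G (lift_word w) = g"
      using w by (simp_all add: reduced_lift_word word_val_lift_word)
  next
    fix u assume u: "u \<in> lists (UNIV \<times> ?S) \<and> reduced_word u \<and> word_val G u = g"
    have "\<exists>u'. u = lift_word u'" if "u \<in> lists (UNIV \<times> ?S)" for u
      using that
    proof (induction u)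
      case Nil
      then show ?case by (intro exI[of _ "[]"]) (simp add: lift_word_def)
    next
      case (Cons x u)
      then obtain u' p k where "u = lift_word u'" "x = (p, val [(True, k)])" by auto
      then show ?case by (intro exI[of _ "(p, k) # u'"]) (simp add: lift_word_def)
    qed
    then obtain u' where u': "u = lift_word u'" using u by blast
    then have "u' = w"
      using u w val_inject[of u' w] by (simp add: reduced_lift_word word_val_lift_word)
    then show "u = lift_word w" by (simp add: u')
  qed
qed

lemma free_group_G: "free_group G"
  unfolding free_group_def
  using free_basis_G subgroup.subgroup_is_group[OF subgroup_\<Gamma> group_Aut_torus] by blast

lemma not_comm_G: "\<not> comm_group G"
proof
  assume "comm_group G"
  then interpret comm_group G .
  let ?a = "[(True, 0)]" and ?b = "[(True, 1)]"
  have "val ?a \<otimes>\<^bsub>G\<^esub> val ?b = val ?b \<otimes>\<^bsub>G\<^esub> val ?a"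
    by (rule m_comm) (simp_all add: \<Gamma>_def)
  then have "val (?a @ ?b) = val (?b @ ?a)"
    unfolding val_append by (simp add: mult_Aut_torus val_Aut)
  then show False
    using val_inject[of "?a @ ?b" "?b @ ?a"] by (simp add: reduced_word_Cons)
qed

text \<open>By \<open>fold_eq_imp_eq\<close> a group element is determined by its effect on one
  nonzero character, so the sets required to be finite in \<open>torus_maps\<close> have at most one
  element.\<close>

lemma mixing_\<Gamma>: "mixing \<Gamma>"
proof -
  interpret torus_maps \<Gamma>
  proof
    fix \<gamma> assume "\<gamma> \<in> \<Gamma>"
    then obtain w where \<gamma>: "\<gamma> = val w" by (auto simp: \<Gamma>_def)
    show "\<gamma> \<in> borel_measurable borel" by (simp add: \<gamma> val_def)
    have "surj (val w)" using val_inv_word(2)[of w] by (metis comp_apply id_apply surjI)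
    then show "distr haar_borel borel \<gamma> = haar_borel" unfolding \<gamma> val_def by (rule distr_tmap)
    show "\<exists>l. \<forall>t. chr k (\<gamma> t) = chr l t" for k using chr_val by (auto simp: \<gamma>)
  next
    fix l k :: "int ^ 'n" assume "l \<noteq> 0"
    let ?X = "{\<gamma> \<in> \<Gamma>. \<forall>t. chr l (\<gamma> t) = chr k t}"
    have "\<gamma> = \<gamma>'" if X: "\<gamma> \<in> ?X" "\<gamma>' \<in> ?X" for \<gamma> \<gamma>'
    proof -
      obtain w w' where w: "reduced_word w" "\<gamma> = val w" "reduced_word w'" "\<gamma>' = val w'"
        using X \<Gamma>_cases by (metis (mono_tags, lifting) mem_Collect_eq)
      have "fold T w l = k" "fold T w' l = k"
        using X by (auto simp: w chr_val intro: chr_eq_imp_eq)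
      then have "w = w'" using fold_eq_imp_eq[OF w(1,3) \<open>l \<noteq> 0\<close>] by simp
      then show ?thesis by (simp add: w)
    qed
    then have "?X = {} \<or> (\<exists>\<gamma>. ?X = {\<gamma>})" by blast
    then show "finite ?X" by (metis (lifting) finite.emptyI finite_insert)
  qed
  show ?thesis by (rule mixing)
qed

text \<open>If \<open>a\<close> and \<open>b\<close> are consecutive generators then \<open>E \<circ> b = (E \<circ> a) * E ^ 3\<close> for the character \<open>E\<close>
  of \<open>v0\<close>, so \<open>E \<circ> a\<close> and \<open>E \<circ> b\<close> cannot both be close to 1 where \<open>E ^ 3\<close> is not.\<close>

lemma not_mixing_of_order_3: "\<not> mixing_of_order 3 \<Gamma>"
proof
  assume mix: "mixing_of_order 3 \<Gamma>"
  let ?E = "chr v0"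
  \<comment> \<open>Two distances below 1/2 add up to less than 1, the threshold in
    \<open>V\<close>.\<close>
  define U where "U = {t. norm (?E t - 1) < 1 / 2}"
  define V where "V = {t. 1 < norm (?E t ^ 3 - 1)}"
  have "open U" "open V"
    unfolding U_def V_def by (intro open_Collect_less continuous_intros continuous_chr)+
  have "(0 :: 'n torus) \<in> U"
  proof -
    have "?E 0 * ?E 0 = ?E 0" by (simp flip: chr_torus_add)
    then show ?thesis by (simp add: U_def)
  qed
  \<comment> \<open>The character has the value cis(pi / 3) here, and its cube -1 is at distance 2
    from 1.\<close>
  have "to_torus (axis i0 (1 / 6)) \<in> V"
  proof -
    have eq: "(\<Sum>i\<in>UNIV. of_int (v0 $ i) * axis i0 (1 / 6) $ i) = (1 / 6 :: real)"
      by (simp add: v0 axis_def if_distrib[of of_int] if_distrib[of "\<lambda>a. _ * a"] cong: if_cong)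
    have "?E (to_torus (axis i0 (1 / 6))) ^ 3 = cis pi"
      unfolding chr_to_torus eq Complex.DeMoivre by simp
    then show ?thesis by (simp add: V_def)
  qed
  have pos: "measure haar U > 0" "measure haar V > 0"
    using \<open>open U\<close> \<open>open V\<close> \<open>0 \<in> U\<close> \<open>_ \<in> V\<close> by (auto intro!: measure_haar_open_pos)
  define B where "B k = (if k = 1 then V else U)" for k :: nat
  have B: "B k \<in> sets haar" for k
    using \<open>open U\<close> \<open>open V\<close> by (simp add: B_def haar_def)
  \<comment> \<open>The full product of measures: an empty intersection then misses it by exactly
    \<open>\<epsilon>\<close>.\<close>
  define \<epsilon> where "\<epsilon> = measure haar V * measure haar U * measure haar U"
  have "\<epsilon> > 0" using pos by (simp add: \<epsilon>_def)
  note mix_B = mix[unfolded mixing_of_order_def, THEN spec[where x = B], THEN mp, OF ballI[OF B],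
      THEN spec[where x = \<epsilon>], THEN mp, OF \<open>\<epsilon> > 0\<close>]
  obtain K where K: "finite K" and
    est: "\<forall>\<gamma>. (\<forall>k\<in>{1..3}. \<gamma> k \<in> \<Gamma>) \<and> (\<forall>i j. 1 < i \<and> i \<le> j \<and> j \<le> 3 \<longrightarrow> comp_seq \<gamma> i j \<notin> K) \<longrightarrow>
      \<bar>measure haar (\<Inter>k\<in>{1..3}. comp_seq \<gamma> 1 k -` B k) - (\<Prod>k\<in>{1..3}. measure haar (B k))\<bar> < \<epsilon>"
    using mix_B by (elim exE conjE)
  define a where "a k = val [(True, k)]" for k
  \<comment> \<open>\<open>c k\<close> is \<open>a (Suc k)\<close> composed with the inverse of
    \<open>a k\<close>. Thus the products to be kept out of \<open>K\<close> are \<open>a k\<close>,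
    \<open>a (Suc k)\<close> and \<open>c k\<close>, all injective in \<open>k\<close>.\<close>
  define c where "c k = val [(True, Suc k), (False, k)]" for k
  have inj_a: "inj a"
    by (rule injI) (simp add: a_def val_letter_inject)
  have "inj c"
  proof (rule injI)
    fix x y assume "c x = c y"
    then show "x = y"
      using val_inject[of "[(True, Suc x), (False, x)]" "[(True, Suc y), (False, y)]"]
      by (simp add: c_def reduced_word_Cons)
  qed
  moreover have "inj (\<lambda>k. a (Suc k))"
    using inj_a by (auto simp: inj_def)
  ultimately have "finite (a -` K \<union> (\<lambda>k. a (Suc k)) -` K \<union> c -` K)"
    using K inj_a by (intro finite_UnI finite_vimageI)
  then have "\<exists>k. k \<notin> a -` K \<union> (\<lambda>k. a (Suc k)) -` K \<union> c -` K"
    by (rule ex_new_if_finite[OF infinite_UNIV_nat])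
  then obtain k where "k \<notin> a -` K \<union> (\<lambda>k. a (Suc k)) -` K \<union> c -` K" ..
  then have k: "a k \<notin> K" "a (Suc k) \<notin> K" "c k \<notin> K" by auto
  \<comment> \<open>Only products starting after the first index must avoid \<open>K\<close>, so the
    first map may be the identity, which leaves \<open>V\<close> in place.\<close>
  define \<gamma> where "\<gamma> i = (if i = 1 then id else if i = 2 then a k else c k)" for i :: nat
  have ca: "c k \<circ> a k = a (Suc k)"
    unfolding c_def a_def val_append[symmetric]
    using inv[of "(False, k)"] by (simp add: val_eq_iff inv')
  have seq: "comp_seq \<gamma> 1 1 = id" "comp_seq \<gamma> 1 2 = a k" "comp_seq \<gamma> 1 3 = a (Suc k)"
    "comp_seq \<gamma> 2 2 = a k" "comp_seq \<gamma> 2 3 = a (Suc k)" "comp_seq \<gamma> 3 3 = c k"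
  proof -
    have "[1..<Suc 1] = [1]" "[1..<Suc 2] = [1, 2]" "[1..<Suc 3] = [1, 2, 3]"
      "[2..<Suc 2] = [2]" "[2..<Suc 3] = [2, 3]" "[3..<Suc 3] = [3]"
      by (simp_all add: upt_rec)
    then show "comp_seq \<gamma> 1 1 = id" "comp_seq \<gamma> 1 2 = a k" "comp_seq \<gamma> 1 3 = a (Suc k)"
      "comp_seq \<gamma> 2 2 = a k" "comp_seq \<gamma> 2 3 = a (Suc k)" "comp_seq \<gamma> 3 3 = c k"
      unfolding comp_seq_def using ca by (simp_all add: \<gamma>_def del: upt_Suc)
  qed
  have "id \<in> \<Gamma>" unfolding \<Gamma>_def by (metis val_Nil rangeI)
  then have "\<forall>k\<in>{1..3}. \<gamma> k \<in> \<Gamma>"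
    by (simp add: \<gamma>_def \<Gamma>_def a_def c_def)
  moreover have "\<forall>i j. 1 < i \<and> i \<le> j \<and> j \<le> 3 \<longrightarrow> comp_seq \<gamma> i j \<notin> K"
  proof (intro allI impI)
    fix i j :: nat assume "1 < i \<and> i \<le> j \<and> j \<le> 3"
    then have "i = 2 \<and> j = 2 \<or> i = 2 \<and> j = 3 \<or> i = 3 \<and> j = 3" by auto
    then show "comp_seq \<gamma> i j \<notin> K" using k seq by auto
  qed
  moreover have "{1..3} = {1, 2, 3 :: nat}" by auto
  ultimately have *: "\<bar>measure haar (V \<inter> (a k -` U \<inter> a (Suc k) -` U)) - measure haar V * (measure haar U * measure haar U)\<bar>
      < \<epsilon>"
    using est[THEN spec[where x = \<gamma>]] by (simp add: seq[unfolded One_nat_def] B_def)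
  have "V \<inter> (a k -` U \<inter> a (Suc k) -` U) = {}"
  proof (rule ccontr)
    assume "V \<inter> (a k -` U \<inter> a (Suc k) -` U) \<noteq> {}"
    then obtain t where t: "t \<in> V" "a k t \<in> U" "a (Suc k) t \<in> U" by blast
    have eq: "T (True, Suc k) v0 = T (True, k) v0 + (v0 + v0 + v0)"
      using relation[of k] by (simp add: algebra_simps)
    have "?E (a (Suc k) t) = chr (T (True, Suc k) v0) t"
      by (simp add: a_def chr_val)
    also have "\<dots> = ?E (a k t) * ?E t ^ 3"
      unfolding eq chr_add by (simp add: a_def chr_val power3_eq_cube)
    finally have "?E (a (Suc k) t) = ?E (a k t) * ?E t ^ 3" .
    then have "norm (?E t ^ 3 - 1) = norm (?E (a (Suc k) t) - ?E (a k t))"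
      using norm_mult[of "?E (a k t)" "?E t ^ 3 - 1"] by (simp add: algebra_simps)
    also have "\<dots> \<le> norm (?E (a (Suc k) t) - 1) + norm (?E (a k t) - 1)"
      using norm_triangle_ineq4[of "?E (a (Suc k) t) - 1" "?E (a k t) - 1"] by simp
    also have "\<dots> < 1" using t(2,3) by (simp add: U_def)
    finally show False using t(1) by (simp add: V_def)
  qed
  with * pos show False by (simp add: \<epsilon>_def mult.assoc)
qed

end

theorem corollary4p9:
  assumes "CARD('n :: finite) \<ge> 2" and "CARD('n) \<notin> {3, 5, 7, 9}"
  shows "\<exists>\<Gamma> :: ('n torus \<Rightarrow> 'n torus) set.
           subgroup \<Gamma> Aut_torus \<and>
           free_group (Aut_torus \<lparr>carrier := \<Gamma>\<rparr>) \<and>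
           \<not> comm_group (Aut_torus \<lparr>carrier := \<Gamma>\<rparr>) \<and>
           mixing \<Gamma> \<and>
           \<not> mixing_of_order 3 \<Gamma>"
proof -
  obtain T :: "bool \<times> nat \<Rightarrow> int ^ 'n \<Rightarrow> int ^ 'n" and v0 i0 where T: "free_letters T"
    "\<And>l v w. T l (v + w) = T l v + T l w" "v0 = axis i0 1"
    "\<And>k. T (True, Suc k) v0 - T (True, k) v0 = v0 + v0 + v0"
    using exists_letters[OF assms] by blast
  interpret torus_letters T v0 i0
    using T by (intro torus_letters.intro torus_letters_axioms.intro)
  show ?thesis
    using subgroup_\<Gamma> free_group_G not_comm_G mixing_\<Gamma> not_mixing_of_order_3 by blast
qed

end
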